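(* The $^\star$-involutive idempotent residuated chains are exactly (up to isomorphism) the nested sums of crownian idempotent residuated chains. Moreover, in a $^\star$-involutive idempotent residuated chain, any two distinct one-generated subalgebras intersect only at $\{1\}$, and each one-generated subalgebra is generated by any of its non-identity elements.
   Context: A residuated lattice is an algebra $(A,\wedge,\vee,\cdot,\backslash,/,1)$ such that $(A,\wedge,\vee)$ is a lattice, $(A,\cdot,1)$ is a monoid, and $y\le x\backslash z \iff x\cdot y\le z\iff x\le z/y$. An idempotent residuated chain is a residuated lattice whose order is total and which satisfies $x\cdot x=x$. Define $x^r:=x\backslash 1$, $x^\ell:=1/x$, $x^\star:=x^\ell\wedge x^r$. It is $^\star$-involutive if $x^{\star\star}=x$ for all $x$. A subalgebra is one-generated if it is generated (as a residuated lattice, so containing $1$) by a single element. Monoidal preorder: $x\sqsubseteq y$ iff $xy=x$; this is a preorder on any idempotent residuated chain $\mathbf A$. Put $A^+=\{x:x\ge 1\}$, $A^-=\{x:x\le 1\}$. Enhanced preorders: preordered sets $P$ with two distinguished subsets $P^+,P^-$. Let $\mathbf 1_L$ be a singleton with $P^+=P$, $P^-=\emptyset$; $\mathbf 1_R$ a singleton with $P^+=\emptyset$, $P^-=P$; $\mathbf 2_L=\{a,b\}$ with $P^+=\{a\}$, $P^-=\{b\}$, $a\sqsubseteq b$ and $b\sqsubseteq a$; $\mathbf 2_R=\{a,b\}$ with $P^+=\{a\}$, $P^-=\{b\}$ and $a,b$ incomparable. The ordinal sum $\bigoplus_{i\in I}\mathbf P_i$ over a chain $I$ is the disjoint union with $x\sqsubseteq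 y$ iff ($x\in P_i$, $y\in P_j$, $i<j$) or ($x,y\in P_i$ and $x\sqsubseteq_{P_i}y$), and with positive and negative parts the unions of those of the summands ($\mathbf P\oplus\mathbf Q$: $\mathbf P$ below $\mathbf Q$). A vertical crown is one of the following, where the topmost summand $\mathbf 1_L$ is the identity element $1$, which is also added to $P^-$ (so $P^+\cap P^-=\{1\}$), $L\subseteq I$ is arbitrary, and $\mathbf P_i=\mathbf 2_L$ for $i\in L$, $\mathbf P_i=\mathbf 2_R$ for $i\in I\setminus L$: (a) $(\bigoplus_{i\in I}\mathbf P_i)\oplus\mathbf 1_L$ with $I=\mathbb Z$; (b) $\mathbf 1_R\oplus(\bigoplus_{i\in I}\mathbf P_i)\oplus\mathbf 1_L$ with $I=\mathbb N$; (c) $(\bigoplus_{i\in I}\mathbf P_i)\oplus\mathbf 1_L\oplus\mathbf 1_L$ with $I=\mathbb N^\partial$ (the order dual of $\mathbb N$); (d) $\mathbf 1_R\oplus(\bigoplus_{i\in I}\mathbf P_i)\oplus\mathbf 1_L\oplus\mathbf 1_L$ with $I=\{1,\dots,n\}$, $n\ge 0$. An idempotent residuated chain $\mathbf A$ is crownian if $(A,\sqsubseteq,A^+,A^-)$ is isomorphic to a vertical crown (with $1$ corresponding to the identity element). Nested sum: let $I$ be a chain (possibly empty, giving the trivial algebra) and $\mathbf A_i$ ($i\in I$) idempotent residuated chains such that, for all $i$ except possibly the top element of $I$ if it exists, $a^\ell\ne 1$ and $a^r\neq 1$ for all non-identity $a\in A_i$. The nested sum $\boxplus_{i\in I}\mathbf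 A_i$ has underlying set $\{1\}\cup\bigcup_{i\in I}(A_i\setminus\{1_{\mathbf A_i}\})$ (disjoint union, all identities being identified); its order and operations extend those of each $\mathbf A_i$, and for $i<j$ and non-identity $a_i\in A_i$, $a_j\in A_j$: $a_i<a_j$ iff $a_i<1_{\mathbf A_i}$; $a_j<a_i$ iff $1_{\mathbf A_i}<a_i$; and $a_i\bullet a_j=a_i\bullet_{\mathbf A_i}1_{\mathbf A_i}$, $a_j\bullet a_i=1_{\mathbf A_i}\bullet_{\mathbf A_i}a_i$ for $\bullet\in\{\cdot,\backslash,/\}$. The result is an idempotent residuated chain. *)

theory Defs
  imports "HOL-Algebra.Group" "HOL.Hull"
begin

section \<open>Residuated lattices\<close>

text \<open>\<open>lres A x z\<close> is the left division of \<open>z\<close> by \<open>x\<close>, usually written with a backslash, and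
  \<open>rres A z y\<close> is \<open>z/y\<close>.\<close>

record 'a rl = "'a monoid" +
  wedge :: "'a \<Rightarrow> 'a \<Rightarrow> 'a"
  vee :: "'a \<Rightarrow> 'a \<Rightarrow> 'a"
  lres :: "'a \<Rightarrow> 'a \<Rightarrow> 'a"
  rres :: "'a \<Rightarrow> 'a \<Rightarrow> 'a"

definition rl_le :: "('a, 'm) rl_scheme \<Rightarrow> 'a \<Rightarrow> 'a \<Rightarrow> bool" where
  "rl_le A x y \<longleftrightarrow> wedge A x y = x"

locale residuated_lattice = monoid A for A (structure) +
  assumes wedge_closed: "\<lbrakk>x \<in> carrier A; y \<in> carrier A\<rbrakk> \<Longrightarrow> wedge A x y \<in> carrier A"
    and vee_closed: "\<lbrakk>x \<in> carrier A; y \<in> carrier A\<rbrakk> \<Longrightarrow> vee A x y \<in> carrier A"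
    and lres_closed: "\<lbrakk>x \<in> carrier A; y \<in> carrier A\<rbrakk> \<Longrightarrow> lres A x y \<in> carrier A"
    and rres_closed: "\<lbrakk>x \<in> carrier A; y \<in> carrier A\<rbrakk> \<Longrightarrow> rres A x y \<in> carrier A"
    and wedge_comm: "\<lbrakk>x \<in> carrier A; y \<in> carrier A\<rbrakk> \<Longrightarrow> wedge A x y = wedge A y x"
    and vee_comm: "\<lbrakk>x \<in> carrier A; y \<in> carrier A\<rbrakk> \<Longrightarrow> vee A x y = vee A y x"
    and wedge_assoc: "\<lbrakk>x \<in> carrier A; y \<in> carrier A; z \<in> carrier A\<rbrakk>
      \<Longrightarrow> wedge A (wedge A x y) z = wedge A x (wedge A y z)"
    and vee_assoc: "\<lbrakk>x \<in> carrier A; y \<in> carrier A; z \<in> carrier A\<rbrakk>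
      \<Longrightarrow> vee A (vee A x y) z = vee A x (vee A y z)"
    and wedge_absorb: "\<lbrakk>x \<in> carrier A; y \<in> carrier A\<rbrakk> \<Longrightarrow> wedge A x (vee A x y) = x"
    and vee_absorb: "\<lbrakk>x \<in> carrier A; y \<in> carrier A\<rbrakk> \<Longrightarrow> vee A x (wedge A x y) = x"
    and lres_residual: "\<lbrakk>x \<in> carrier A; y \<in> carrier A; z \<in> carrier A\<rbrakk>
      \<Longrightarrow> rl_le A y (lres A x z) \<longleftrightarrow> rl_le A (x \<otimes> y) z"
    and rres_residual: "\<lbrakk>x \<in> carrier A; y \<in> carrier A; z \<in> carrier A\<rbrakk>
      \<Longrightarrow> rl_le A (x \<otimes> y) z \<longleftrightarrow> rl_le A x (rres A z y)"

locale idempotent_residuated_chain = residuated_lattice A for A (structure) +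
  assumes le_total: "\<lbrakk>x \<in> carrier A; y \<in> carrier A\<rbrakk> \<Longrightarrow> rl_le A x y \<or> rl_le A y x"
    and idem: "x \<in> carrier A \<Longrightarrow> x \<otimes> x = x"

definition rneg :: "('a, 'm) rl_scheme \<Rightarrow> 'a \<Rightarrow> 'a" where
  "rneg A x = lres A x \<one>\<^bsub>A\<^esub>"

definition lneg :: "('a, 'm) rl_scheme \<Rightarrow> 'a \<Rightarrow> 'a" where
  "lneg A x = rres A \<one>\<^bsub>A\<^esub> x"

definition rl_star :: "('a, 'm) rl_scheme \<Rightarrow> 'a \<Rightarrow> 'a" where
  "rl_star A x = wedge A (lneg A x) (rneg A x)"

locale star_involutive_irc = idempotent_residuated_chain A for A (structure) +
  assumes star_star: "x \<in> carrier A \<Longrightarrow> rl_star A (rl_star A x) = x"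

text \<open>Preservation of the identity is implied by surjectivity, but is part of the usual
  definition. If \<open>A\<close> is closed under its operations, then so is any \<open>B\<close> with
  \<open>rl_iso A B h\<close>, so the notion is meant to be used with \<open>A\<close> known to be an algebra.\<close>

definition rl_iso :: "('a, 'm) rl_scheme \<Rightarrow> ('b, 'n) rl_scheme \<Rightarrow> ('a \<Rightarrow> 'b) \<Rightarrow> bool" where
  "rl_iso A B h \<longleftrightarrow> bij_betw h (carrier A) (carrier B) \<and> h \<one>\<^bsub>A\<^esub> = \<one>\<^bsub>B\<^esub> \<and>
     (\<forall>x \<in> carrier A. \<forall>y \<in> carrier A.
        h (x \<otimes>\<^bsub>A\<^esub> y) = h x \<otimes>\<^bsub>B\<^esub> h y \<and>
        h (wedge A x y) = wedge B (h x) (h y) \<and>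
        h (vee A x y) = vee B (h x) (h y) \<and>
        h (lres A x y) = lres B (h x) (h y) \<and>
        h (rres A x y) = rres B (h x) (h y))"

definition rl_isomorphic :: "('a, 'm) rl_scheme \<Rightarrow> ('b, 'n) rl_scheme \<Rightarrow> bool" where
  "rl_isomorphic A B \<longleftrightarrow> (\<exists>h. rl_iso A B h)"

definition subuniverse :: "('a, 'm) rl_scheme \<Rightarrow> 'a set \<Rightarrow> bool" where
  "subuniverse A S \<longleftrightarrow> S \<subseteq> carrier A \<and> \<one>\<^bsub>A\<^esub> \<in> S \<and>
     (\<forall>x \<in> S. \<forall>y \<in> S. x \<otimes>\<^bsub>A\<^esub> y \<in> S \<and> wedge A x y \<in> S \<and> vee A x y \<in> S \<and>
        lres A x y \<in> S \<and> rres A x y \<in> S)"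

definition one_generated :: "('a, 'm) rl_scheme \<Rightarrow> 'a set \<Rightarrow> bool" where
  "one_generated A S \<longleftrightarrow> (\<exists>x \<in> carrier A. S = subuniverse A hull {x})"


section \<open>Enhanced preorders and vertical crowns\<close>

record 'p epreorder =
  pts :: "'p set"
  sqle :: "'p \<Rightarrow> 'p \<Rightarrow> bool"
  pos :: "'p set"
  neg :: "'p set"

definition one_L :: "unit epreorder" where
  "one_L = \<lparr>pts = UNIV, sqle = (\<lambda>_ _. True), pos = UNIV, neg = {}\<rparr>"

definition one_R :: "unit epreorder" where
  "one_R = \<lparr>pts = UNIV, sqle = (\<lambda>_ _. True), pos = {}, neg = UNIV\<rparr>"

datatype two = pt_a | pt_b

definition two_L :: "two epreorder" where
  "two_L = \<lparr>pts = UNIV, sqle = (\<lambda>_ _. True), pos = {pt_a}, neg = {pt_b}\<rparr>"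

definition two_R :: "two epreorder" where
  "two_R = \<lparr>pts = UNIV, sqle = (=), pos = {pt_a}, neg = {pt_b}\<rparr>"

definition ordinal_sum ::
  "'i set \<Rightarrow> ('i \<times> 'i) set \<Rightarrow> ('i \<Rightarrow> 'p epreorder) \<Rightarrow> ('i \<times> 'p) epreorder" where
  "ordinal_sum I r P =
     \<lparr>pts = (SIGMA i:I. pts (P i)),
      sqle = (\<lambda>(i, x) (j, y). (i \<noteq> j \<and> (i, j) \<in> r) \<or> (i = j \<and> sqle (P i) x y)),
      pos = (SIGMA i:I. pos (P i)),
      neg = (SIGMA i:I. neg (P i))\<rparr>"

definition ordinal_plus :: "'p epreorder \<Rightarrow> 'q epreorder \<Rightarrow> ('p + 'q) epreorder" where
  "ordinal_plus P Q =
     \<lparr>pts = pts P <+> pts Q,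
      sqle = (\<lambda>x y. case (x, y) of
          (Inl p, Inl p') \<Rightarrow> sqle P p p'
        | (Inl _, Inr _) \<Rightarrow> True
        | (Inr _, Inl _) \<Rightarrow> False
        | (Inr q, Inr q') \<Rightarrow> sqle Q q q'),
      pos = pos P <+> pos Q,
      neg = neg P <+> neg Q\<rparr>"

text \<open>The topmost summand of a vertical crown: \<open>\<one>\<^sub>L\<close> with its point \<open>Inr ()\<close>, the identity,
  also made negative.\<close>

definition with_identity :: "'p epreorder \<Rightarrow> ('p + unit) epreorder" where
  "with_identity P = (let Q = ordinal_plus P one_L in Q\<lparr>neg := insert (Inr ()) (neg Q)\<rparr>)"

definition pairs_sum :: "'i set \<Rightarrow> ('i \<times> 'i) set \<Rightarrow> 'i set \<Rightarrow> ('i \<times> two) epreorder" where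
  "pairs_sum I r L = ordinal_sum I r (\<lambda>i. if i \<in> L then two_L else two_R)"

definition crown_Z :: "int set \<Rightarrow> (int \<times> two + unit) epreorder" where
  "crown_Z L = with_identity (pairs_sum UNIV {(i, j). i \<le> j} L)"

definition crown_N :: "nat set \<Rightarrow> ((unit + nat \<times> two) + unit) epreorder" where
  "crown_N L = with_identity (ordinal_plus one_R (pairs_sum UNIV {(i, j). i \<le> j} L))"

definition crown_N_dual :: "nat set \<Rightarrow> ((nat \<times> two + unit) + unit) epreorder" where
  "crown_N_dual L = with_identity (ordinal_plus (pairs_sum UNIV {(i, j). j \<le> i} L) one_L)"

definition crown_fin :: "nat \<Rightarrow> nat set \<Rightarrow> (((unit + nat \<times> two) + unit) + unit) epreorder" where
  "crown_fin n L =
     with_identity (ordinal_plus (ordinal_plus one_R (pairs_sum {1..n} {(i, j). i \<le> j} L)) one_L)"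

definition rl_epreorder :: "('a, 'm) rl_scheme \<Rightarrow> 'a epreorder" where
  "rl_epreorder A =
     \<lparr>pts = carrier A,
      sqle = (\<lambda>x y. x \<otimes>\<^bsub>A\<^esub> y = x),
      pos = {x \<in> carrier A. rl_le A \<one>\<^bsub>A\<^esub> x},
      neg = {x \<in> carrier A. rl_le A x \<one>\<^bsub>A\<^esub>}\<rparr>"

definition epreorder_iso :: "'p epreorder \<Rightarrow> 'q epreorder \<Rightarrow> ('p \<Rightarrow> 'q) \<Rightarrow> bool" where
  "epreorder_iso P Q f \<longleftrightarrow> bij_betw f (pts P) (pts Q) \<and>
     (\<forall>x \<in> pts P. \<forall>y \<in> pts P. sqle P x y \<longleftrightarrow> sqle Q (f x) (f y)) \<and>
     (\<forall>x \<in> pts P. (x \<in> pos P \<longleftrightarrow> f x \<in> pos Q) \<and> (x \<in> neg P \<longleftrightarrow> f x \<in> neg Q))"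

definition has_crown :: "('a, 'm) rl_scheme \<Rightarrow> ('p + unit) epreorder \<Rightarrow> bool" where
  "has_crown A C \<longleftrightarrow> (\<exists>f. epreorder_iso (rl_epreorder A) C f \<and> f \<one>\<^bsub>A\<^esub> = Inr ())"

definition crownian :: "('a, 'm) rl_scheme \<Rightarrow> bool" where
  "crownian A \<longleftrightarrow> idempotent_residuated_chain A \<and>
     ((\<exists>L. has_crown A (crown_Z L)) \<or>
      (\<exists>L. has_crown A (crown_N L)) \<or>
      (\<exists>L. has_crown A (crown_N_dual L)) \<or>
      (\<exists>n. \<exists>L \<subseteq> {1..n}. has_crown A (crown_fin n L)))"


section \<open>Nested sums\<close>

text \<open>The reflexive relation \<open>r\<close> is the order of the index chain. The last clause is the side
  condition on all summands except the one at the top of the chain, if there is a top.\<close>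

definition nestable :: "'i set \<Rightarrow> ('i \<times> 'i) set \<Rightarrow> ('i \<Rightarrow> ('a, 'm) rl_scheme) \<Rightarrow> bool" where
  "nestable I r A \<longleftrightarrow> linear_order_on I r \<and>
     (\<forall>i \<in> I. idempotent_residuated_chain (A i)) \<and>
     (\<forall>i \<in> I. \<not> (\<forall>j \<in> I. (j, i) \<in> r) \<longrightarrow>
        (\<forall>a \<in> carrier (A i). a \<noteq> \<one>\<^bsub>A i\<^esub> \<longrightarrow>
           lneg (A i) a \<noteq> \<one>\<^bsub>A i\<^esub> \<and> rneg (A i) a \<noteq> \<one>\<^bsub>A i\<^esub>))"

text \<open>In a nested sum, \<open>None\<close> is the common identity and \<open>Some (i, a)\<close> is the non-identity element
  \<open>a\<close> of the \<open>i\<close>-th summand.\<close>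

definition nest_emb :: "('i \<Rightarrow> ('a, 'm) rl_scheme) \<Rightarrow> 'i \<Rightarrow> 'a \<Rightarrow> ('i \<times> 'a) option" where
  "nest_emb A i a = (if a = \<one>\<^bsub>A i\<^esub> then None else Some (i, a))"

definition nest_le :: "('i \<times> 'i) set \<Rightarrow> ('i \<Rightarrow> ('a, 'm) rl_scheme) \<Rightarrow>
    ('i \<times> 'a) option \<Rightarrow> ('i \<times> 'a) option \<Rightarrow> bool" where
  "nest_le r A x y = (case (x, y) of
      (None, None) \<Rightarrow> True
    | (Some (i, a), None) \<Rightarrow> rl_le (A i) a \<one>\<^bsub>A i\<^esub>
    | (None, Some (j, b)) \<Rightarrow> rl_le (A j) \<one>\<^bsub>A j\<^esub> b
    | (Some (i, a), Some (j, b)) \<Rightarrow>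
        if i = j then rl_le (A i) a b
        else if (i, j) \<in> r then rl_le (A i) a \<one>\<^bsub>A i\<^esub>
        else rl_le (A j) \<one>\<^bsub>A j\<^esub> b)"

text \<open>The common pattern of the product and the two residuals: between different summands, the operation is carried
  out in the one with the smaller index, with the other argument replaced by the identity. Applied
  to \<open>None\<close> twice it gives \<open>None\<close>, since each of the three operations maps the pair of identities
  to the identity.\<close>

definition nest_op :: "('i \<times> 'i) set \<Rightarrow> ('i \<Rightarrow> ('a, 'm) rl_scheme) \<Rightarrow>
    (('a, 'm) rl_scheme \<Rightarrow> 'a \<Rightarrow> 'a \<Rightarrow> 'a) \<Rightarrow>
    ('i \<times> 'a) option \<Rightarrow> ('i \<times> 'a) option \<Rightarrow> ('i \<times> 'a) option" where
  "nest_op r A f x y = (case (x, y) of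
      (None, None) \<Rightarrow> None
    | (Some (i, a), None) \<Rightarrow> nest_emb A i (f (A i) a \<one>\<^bsub>A i\<^esub>)
    | (None, Some (j, b)) \<Rightarrow> nest_emb A j (f (A j) \<one>\<^bsub>A j\<^esub> b)
    | (Some (i, a), Some (j, b)) \<Rightarrow>
        if i = j then nest_emb A i (f (A i) a b)
        else if (i, j) \<in> r then nest_emb A i (f (A i) a \<one>\<^bsub>A i\<^esub>)
        else nest_emb A j (f (A j) \<one>\<^bsub>A j\<^esub> b))"

definition nested_sum :: "'i set \<Rightarrow> ('i \<times> 'i) set \<Rightarrow> ('i \<Rightarrow> ('a, 'm) rl_scheme) \<Rightarrow>
    ('i \<times> 'a) option rl" where
  "nested_sum I r A =
     \<lparr>carrier = insert None (Some ` (SIGMA i:I. carrier (A i) - {\<one>\<^bsub>A i\<^esub>})),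
      mult = nest_op r A mult,
      one = None,
      wedge = (\<lambda>x y. if nest_le r A x y then x else y),
      vee = (\<lambda>x y. if nest_le r A x y then y else x),
      lres = nest_op r A lres,
      rres = nest_op r A rres\<rparr>"

end

(* The product of two elements of an idempotent residuated chain A is one of the factors: their meet
  if it lies below 1, and their join otherwise. Elements of equal sign commute, and by associativity
  an element fails to commute with at most one other. So each x has two neighbours, its star x* (the
  smaller of x^l and x^r) and circ x (the larger of the two); if they differ, circ x is the one
  element that does not commute with x. If x** = x, both neighbour relations are symmetric, and the
  components of the resulting graph, together with 1, are the one-generated subalgebras. Every
  component is a path, on which the two kinds of steps alternate; walking along it enumerates the
  component by an interval of integers and exhibits it as a crown. Elements x, y of different
  components satisfy xy = yx = x or xy = yx = y, which of the two depends only on the components, and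
  the nested sum structure follows. *)

theory Submission
  imports Defs
begin

text \<open>The pairs \<open>two_L\<close> and \<open>two_R\<close> of a crown are the
  \<open>circ\<close> edges: such a pair is equivalent or incomparable in the monoidal preorder,
  depending on the side on which its product is negative. The star edges run between consecutive
  pairs, from a negative point to the positive point of the next pair above. A path can end only
  where star and \<open>circ\<close> coincide; such an element stays without a partner. An unpaired
  negative element is the bottom summand \<open>one_R\<close>, an unpaired positive one the summand
  \<open>one_L\<close> under the identity, whence the four shapes of a crown. In the converse
  direction, an isomorphism with a crown says nothing about residuals, so the star has to be
  recovered from products and signs. For nested sums the obstacle is a residual that collapses to
  the identity and so loses its index. The side condition on the summands prevents this at every
  index but the top one, and above the top only the identity is left.\<close>

section \<open>Order and multiplication\<close>

context residuated_lattice
begin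

abbreviation le (infix "\<preceq>" 50) where "x \<preceq> y \<equiv> rl_le A x y"

lemma le_refl: "x \<in> carrier A \<Longrightarrow> x \<preceq> x"
  unfolding rl_le_def by (metis vee_absorb wedge_absorb wedge_closed)

lemma le_antisym: "\<lbrakk>x \<preceq> y; y \<preceq> x; x \<in> carrier A; y \<in> carrier A\<rbrakk> \<Longrightarrow> x = y"
  unfolding rl_le_def by (metis wedge_comm)

lemma le_trans:
  "\<lbrakk>x \<preceq> y; y \<preceq> z; x \<in> carrier A; y \<in> carrier A; z \<in> carrier A\<rbrakk> \<Longrightarrow> x \<preceq> z"
  unfolding rl_le_def by (metis wedge_assoc)

lemma mult_left_mono:
  assumes "x \<preceq> y" "x \<in> carrier A" "y \<in> carrier A" "z \<in> carrier A"
  shows "z \<otimes> x \<preceq> z \<otimes> y"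
proof -
  have "y \<preceq> lres A z (z \<otimes> y)"
    using assms by (simp add: lres_residual le_refl)
  then have "x \<preceq> lres A z (z \<otimes> y)"
    using assms le_trans lres_closed m_closed by meson
  then show ?thesis
    using assms by (simp add: lres_residual)
qed

lemma mult_right_mono:
  assumes "x \<preceq> y" "x \<in> carrier A" "y \<in> carrier A" "z \<in> carrier A"
  shows "x \<otimes> z \<preceq> y \<otimes> z"
proof -
  have "y \<preceq> rres A (y \<otimes> z) z"
    using assms by (simp flip: rres_residual add: le_refl)
  then have "x \<preceq> rres A (y \<otimes> z) z"
    using assms le_trans rres_closed m_closed by meson
  then show ?thesis
    using assms by (simp add: rres_residual)
qed

lemma vee_eq_right: "\<lbrakk>x \<preceq> y; x \<in> carrier A; y \<in> carrier A\<rbrakk> \<Longrightarrow> vee A x y = y"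
  unfolding rl_le_def by (metis vee_absorb vee_comm wedge_comm)

text \<open>The adjunction determines the residual, so a closed form (\<open>lres_eq\<close>) or an
  image under an isomorphism (\<open>rl_isoI\<close>) is identified by testing it against all
  \<open>y\<close>.\<close>

lemma lres_unique:
  assumes "x \<in> carrier A" "z \<in> carrier A" "w \<in> carrier A"
    and "\<And>y. y \<in> carrier A \<Longrightarrow> y \<preceq> w \<longleftrightarrow> x \<otimes> y \<preceq> z"
  shows "w = lres A x z"
  using assms le_antisym le_refl lres_closed lres_residual by metis

lemma rres_unique:
  assumes "x \<in> carrier A" "z \<in> carrier A" "w \<in> carrier A"
    and "\<And>y. y \<in> carrier A \<Longrightarrow> y \<preceq> w \<longleftrightarrow> y \<otimes> x \<preceq> z"
  shows "w = rres A z x"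
  using assms le_antisym le_refl rres_closed rres_residual by metis

lemma lneg_closed [simp]: "x \<in> carrier A \<Longrightarrow> lneg A x \<in> carrier A"
  by (simp add: lneg_def rres_closed)

lemma rneg_closed [simp]: "x \<in> carrier A \<Longrightarrow> rneg A x \<in> carrier A"
  by (simp add: rneg_def lres_closed)

lemma le_lneg_iff:
  "\<lbrakk>x \<in> carrier A; y \<in> carrier A\<rbrakk> \<Longrightarrow> y \<preceq> lneg A x \<longleftrightarrow> y \<otimes> x \<preceq> \<one>"
  by (simp add: lneg_def rres_residual)

lemma le_rneg_iff:
  "\<lbrakk>x \<in> carrier A; y \<in> carrier A\<rbrakk> \<Longrightarrow> y \<preceq> rneg A x \<longleftrightarrow> x \<otimes> y \<preceq> \<one>"
  by (simp add: rneg_def lres_residual)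

lemma lneg_one [simp]: "lneg A \<one> = \<one>"
  by (metis le_antisym le_lneg_iff le_refl lneg_closed one_closed r_one)

lemma rneg_one [simp]: "rneg A \<one> = \<one>"
  by (metis le_antisym le_rneg_iff le_refl rneg_closed one_closed l_one)

lemma star_closed [simp]: "x \<in> carrier A \<Longrightarrow> rl_star A x \<in> carrier A"
  by (simp add: rl_star_def wedge_closed)

end

text \<open>Meet and join forget which of \<open>lneg\<close>, \<open>rneg\<close> is the larger
  one. This lost information comes back as the set \<open>L\<close> of a crown.\<close>

definition circ :: "('a, 'm) rl_scheme \<Rightarrow> 'a \<Rightarrow> 'a" where
  "circ A x = vee A (lneg A x) (rneg A x)"

section \<open>Products in a chain and closed formulas for the residuals\<close>

context idempotent_residuated_chain
begin

lemma not_le: "\<lbrakk>\<not> x \<preceq> y; x \<in> carrier A; y \<in> carrier A\<rbrakk> \<Longrightarrow> y \<preceq> x"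
  using le_total by blast

lemma wedge_eq:
  "\<lbrakk>x \<in> carrier A; y \<in> carrier A\<rbrakk> \<Longrightarrow> wedge A x y = (if x \<preceq> y then x else y)"
  by (metis not_le rl_le_def wedge_comm)

lemma vee_eq:
  "\<lbrakk>x \<in> carrier A; y \<in> carrier A\<rbrakk> \<Longrightarrow> vee A x y = (if x \<preceq> y then y else x)"
  by (metis not_le vee_eq_right vee_comm)

text \<open>A squeeze: the larger factor is below the product because the other factor is above 1,
  and the product is below the square of the larger factor, which is that factor itself.\<close>

lemma pos_mult:
  assumes "x \<in> carrier A" "y \<in> carrier A" "\<one> \<preceq> x" "\<one> \<preceq> y"
  shows "x \<otimes> y = (if x \<preceq> y then y else x)"
proof (cases "x \<preceq> y")
  case True
  have "x \<otimes> y \<preceq> y"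
    using mult_right_mono[OF True, of y] assms by (simp add: idem)
  moreover have "y \<preceq> x \<otimes> y"
    using mult_right_mono[of \<one> x y] assms by simp
  ultimately show ?thesis
    using True assms le_antisym by simp
next
  case False
  then have le: "y \<preceq> x"
    using assms not_le by blast
  have "x \<otimes> y \<preceq> x"
    using mult_left_mono[OF le, of x] assms by (simp add: idem)
  moreover have "x \<preceq> x \<otimes> y"
    using mult_left_mono[of \<one> y x] assms by simp
  ultimately show ?thesis
    using False assms le_antisym by simp
qed

lemma neg_mult:
  assumes "x \<in> carrier A" "y \<in> carrier A" "x \<preceq> \<one>" "y \<preceq> \<one>"
  shows "x \<otimes> y = (if x \<preceq> y then x else y)"
proof (cases "x \<preceq> y")
  case True
  have "x \<preceq> x \<otimes> y"
    using mult_left_mono[OF True, of x] assms by (simp add: idem)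
  moreover have "x \<otimes> y \<preceq> x"
    using mult_left_mono[of y \<one> x] assms by simp
  ultimately show ?thesis
    using True assms le_antisym by simp
next
  case False
  then have le: "y \<preceq> x"
    using assms not_le by blast
  have "y \<preceq> x \<otimes> y"
    using mult_right_mono[OF le, of y] assms by (simp add: idem)
  moreover have "x \<otimes> y \<preceq> y"
    using mult_right_mono[of x \<one> y] assms by simp
  ultimately show ?thesis
    using False assms le_antisym by simp
qed

text \<open>Mixed signs are reduced to equal signs. By idempotence
  \<open>x \<otimes> (x \<otimes> y)\<close> and \<open>(x \<otimes> y) \<otimes> y\<close> both
  equal \<open>x \<otimes> y\<close>; if this is negative, the former is a product of two negative
  elements, otherwise the latter is one of two positive elements.\<close>

lemma mult_eq_neg_pos:
  assumes "x \<in> carrier A" "y \<in> carrier A" "x \<preceq> \<one>" "\<one> \<preceq> y"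
  shows "x \<otimes> y = (if x \<otimes> y \<preceq> \<one> then x else y)"
proof (cases "x \<otimes> y \<preceq> \<one>")
  case True
  have "x \<preceq> x \<otimes> y"
    using mult_left_mono[of \<one> y x] assms by simp
  moreover have "x \<otimes> (x \<otimes> y) = x \<otimes> y"
    using assms by (simp flip: m_assoc add: idem)
  ultimately show ?thesis
    using neg_mult[of x "x \<otimes> y"] True assms by simp
next
  case False
  then have "\<one> \<preceq> x \<otimes> y"
    using assms not_le by simp
  moreover have "x \<otimes> y \<preceq> y"
    using mult_right_mono[of x \<one> y] assms by simp
  moreover have "(x \<otimes> y) \<otimes> y = x \<otimes> y"
    using assms by (simp add: m_assoc idem)
  ultimately show ?thesis
    using pos_mult[of "x \<otimes> y" y] False assms by simp
qed

lemma mult_eq_pos_neg: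
  assumes "x \<in> carrier A" "y \<in> carrier A" "\<one> \<preceq> x" "y \<preceq> \<one>"
  shows "x \<otimes> y = (if x \<otimes> y \<preceq> \<one> then y else x)"
proof (cases "x \<otimes> y \<preceq> \<one>")
  case True
  have "y \<preceq> x \<otimes> y"
    using mult_right_mono[of \<one> x y] assms by simp
  moreover have "(x \<otimes> y) \<otimes> y = x \<otimes> y"
    using assms by (simp add: m_assoc idem)
  ultimately show ?thesis
    using neg_mult[of "x \<otimes> y" y] True assms le_antisym by (auto split: if_splits)
next
  case False
  then have "\<one> \<preceq> x \<otimes> y"
    using assms not_le by simp
  moreover have "x \<otimes> y \<preceq> x"
    using mult_left_mono[of y \<one> x] assms by simp
  moreover have "x \<otimes> (x \<otimes> y) = x \<otimes> y"
    using assms by (simp flip: m_assoc add: idem)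
  ultimately show ?thesis
    using pos_mult[of x "x \<otimes> y"] False assms le_antisym by (auto split: if_splits)
qed

lemma mult_eq:
  assumes "x \<in> carrier A" "y \<in> carrier A"
  shows "x \<otimes> y = (if x \<otimes> y \<preceq> \<one> then wedge A x y else vee A x y)"
proof -
  consider "\<one> \<preceq> x" "\<one> \<preceq> y" | "x \<preceq> \<one>" "y \<preceq> \<one>"
    | "x \<preceq> \<one>" "\<one> \<preceq> y" | "\<one> \<preceq> x" "y \<preceq> \<one>"
    using assms le_total one_closed by metis
  then show ?thesis
  proof cases
    case 1
    then have xy: "x \<otimes> y = vee A x y"
      using assms by (simp add: pos_mult vee_eq)
    show ?thesis
    proof (cases "x \<otimes> y \<preceq> \<one>")
      case True
      have "x \<preceq> x \<otimes> y" "y \<preceq> x \<otimes> y"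
        using mult_left_mono[of \<one> y x] mult_right_mono[of \<one> x y] 1 assms by simp_all
      then have "x \<preceq> \<one>" "y \<preceq> \<one>"
        using True assms le_trans m_closed one_closed by blast+
      then have "x = \<one>" "y = \<one>"
        using 1 assms le_antisym by blast+
      then show ?thesis
        by (simp add: wedge_eq le_refl)
    qed (simp add: xy)
  next
    case 2
    then show ?thesis
      using neg_mult[of x y] assms by (auto simp: wedge_eq vee_eq split: if_splits)
  next
    case 3
    then have "x \<preceq> y"
      using le_trans assms by blast
    then show ?thesis
      using mult_eq_neg_pos[of x y] 3 assms by (auto simp: wedge_eq vee_eq split: if_splits)
  next
    case 4
    then have "y \<preceq> x"
      using le_trans assms by blast
    then show ?thesis
      using mult_eq_pos_neg[of x y] 4 assms le_antisym[of x y] by (auto simp: wedge_eq vee_eq split: if_splits)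
  qed
qed

lemma mult_cases: "\<lbrakk>x \<in> carrier A; y \<in> carrier A\<rbrakk> \<Longrightarrow> x \<otimes> y = x \<or> x \<otimes> y = y"
  using mult_eq[of x y] by (auto simp: wedge_eq vee_eq split: if_splits)

lemma mult_le_left:
  "\<lbrakk>x \<otimes> y \<preceq> \<one>; x \<in> carrier A; y \<in> carrier A\<rbrakk> \<Longrightarrow> x \<otimes> y \<preceq> x"
  using mult_eq[of x y] by (auto simp: wedge_eq le_refl not_le split: if_splits)

lemma mult_le_right:
  "\<lbrakk>x \<otimes> y \<preceq> \<one>; x \<in> carrier A; y \<in> carrier A\<rbrakk> \<Longrightarrow> x \<otimes> y \<preceq> y"
  using mult_eq[of x y] by (auto simp: wedge_eq le_refl not_le split: if_splits)

lemma le_mult_left: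
  "\<lbrakk>\<not> x \<otimes> y \<preceq> \<one>; x \<in> carrier A; y \<in> carrier A\<rbrakk> \<Longrightarrow> x \<preceq> x \<otimes> y"
  using mult_eq[of x y] by (auto simp: vee_eq le_refl not_le split: if_splits)

lemma le_mult_right:
  "\<lbrakk>\<not> x \<otimes> y \<preceq> \<one>; x \<in> carrier A; y \<in> carrier A\<rbrakk> \<Longrightarrow> y \<preceq> x \<otimes> y"
  using mult_eq[of x y] by (auto simp: vee_eq le_refl not_le split: if_splits)

lemma le_of_mult_le:
  assumes "x \<otimes> y \<preceq> z" "\<not> x \<otimes> y \<preceq> \<one>" "x \<in> carrier A" "y \<in> carrier A" "z \<in> carrier A"
  shows "x \<preceq> z" "y \<preceq> z"
  using assms le_mult_left le_mult_right le_trans m_closed by meson+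

text \<open>A product never collapses to the identity. In a nested sum this keeps the smallest index
  of the factors visible in the product.\<close>

lemma mult_eq_one_iff:
  assumes "x \<in> carrier A" "y \<in> carrier A"
  shows "x \<otimes> y = \<one> \<longleftrightarrow> x = \<one> \<and> y = \<one>"
  using mult_cases[OF assms] assms by auto

text \<open>As the product is one of its factors, \<open>x \<otimes> y \<preceq> z\<close> splits:
  for \<open>x \<preceq> z\<close> it means that \<open>x \<otimes> y\<close> is negative or
  \<open>y \<preceq> z\<close>, otherwise that both hold. So the residuals reduce to negations and
  the order.\<close>

lemma lres_eq:
  assumes x: "x \<in> carrier A" and z: "z \<in> carrier A"
  shows "lres A x z = (if x \<preceq> z then vee A (rneg A x) z else wedge A (rneg A x) z)"
proof (cases "x \<preceq> z")
  case True
  have "vee A (rneg A x) z = lres A x z"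
  proof (rule lres_unique[OF x z])
    fix y assume y: "y \<in> carrier A"
    have "y \<preceq> vee A (rneg A x) z \<longleftrightarrow> y \<preceq> rneg A x \<or> y \<preceq> z"
      using x y z le_trans[of y "rneg A x" z] le_trans[of y z "rneg A x"]
        not_le[of "rneg A x" z] by (auto simp: vee_eq)
    also have "\<dots> \<longleftrightarrow> x \<otimes> y \<preceq> \<one> \<or> y \<preceq> z"
      using x y by (simp add: le_rneg_iff)
    also have "\<dots> \<longleftrightarrow> x \<otimes> y \<preceq> z"
      using mult_cases[OF x y] mult_le_left[of x y] le_of_mult_le[of x y z] le_trans[of _ x z] True x y z
      by (metis m_closed)
    finally show "y \<preceq> vee A (rneg A x) z \<longleftrightarrow> x \<otimes> y \<preceq> z" .
  qed (use x z in \<open>simp add: vee_closed\<close>)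
  then show ?thesis
    using True by simp
next
  case False
  have "wedge A (rneg A x) z = lres A x z"
  proof (rule lres_unique[OF x z])
    fix y assume y: "y \<in> carrier A"
    have "y \<preceq> wedge A (rneg A x) z \<longleftrightarrow> y \<preceq> rneg A x \<and> y \<preceq> z"
      using x y z le_trans[of y "rneg A x" z] le_trans[of y z "rneg A x"]
        not_le[of "rneg A x" z] by (auto simp: wedge_eq)
    also have "\<dots> \<longleftrightarrow> x \<otimes> y \<preceq> \<one> \<and> y \<preceq> z"
      using x y by (simp add: le_rneg_iff)
    also have "\<dots> \<longleftrightarrow> x \<otimes> y \<preceq> z"
      using mult_cases[OF x y] mult_le_right[of x y] le_of_mult_le[of x y z] le_trans[of _ y z] False x y z
      by (metis m_closed)
    finally show "y \<preceq> wedge A (rneg A x) z \<longleftrightarrow> x \<otimes> y \<preceq> z" .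
  qed (use x z in \<open>simp add: wedge_closed\<close>)
  then show ?thesis
    using False by simp
qed

lemma rres_eq:
  assumes x: "x \<in> carrier A" and z: "z \<in> carrier A"
  shows "rres A z x = (if x \<preceq> z then vee A (lneg A x) z else wedge A (lneg A x) z)"
proof (cases "x \<preceq> z")
  case True
  have "vee A (lneg A x) z = rres A z x"
  proof (rule rres_unique[OF x z])
    fix y assume y: "y \<in> carrier A"
    have "y \<preceq> vee A (lneg A x) z \<longleftrightarrow> y \<preceq> lneg A x \<or> y \<preceq> z"
      using x y z le_trans[of y "lneg A x" z] le_trans[of y z "lneg A x"]
        not_le[of "lneg A x" z] by (auto simp: vee_eq)
    also have "\<dots> \<longleftrightarrow> y \<otimes> x \<preceq> \<one> \<or> y \<preceq> z"
      using x y by (simp add: le_lneg_iff)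
    also have "\<dots> \<longleftrightarrow> y \<otimes> x \<preceq> z"
      using mult_cases[OF y x] mult_le_right[of y x] le_of_mult_le[of y x z] le_trans[of _ x z] True x y z
      by (metis m_closed)
    finally show "y \<preceq> vee A (lneg A x) z \<longleftrightarrow> y \<otimes> x \<preceq> z" .
  qed (use x z in \<open>simp add: vee_closed\<close>)
  then show ?thesis
    using True by simp
next
  case False
  have "wedge A (lneg A x) z = rres A z x"
  proof (rule rres_unique[OF x z])
    fix y assume y: "y \<in> carrier A"
    have "y \<preceq> wedge A (lneg A x) z \<longleftrightarrow> y \<preceq> lneg A x \<and> y \<preceq> z"
      using x y z le_trans[of y "lneg A x" z] le_trans[of y z "lneg A x"]
        not_le[of "lneg A x" z] by (auto simp: wedge_eq)
    also have "\<dots> \<longleftrightarrow> y \<otimes> x \<preceq> \<one> \<and> y \<preceq> z"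
      using x y by (simp add: le_lneg_iff)
    also have "\<dots> \<longleftrightarrow> y \<otimes> x \<preceq> z"
      using mult_cases[OF y x] mult_le_left[of y x] le_of_mult_le[of y x z] le_trans[of _ y z] False x y z
      by (metis m_closed)
    finally show "y \<preceq> wedge A (lneg A x) z \<longleftrightarrow> y \<otimes> x \<preceq> z" .
  qed (use x z in \<open>simp add: wedge_closed\<close>)
  then show ?thesis
    using False by simp
qed

section \<open>The star, \<open>circ\<close> and non-commuting pairs\<close>

lemma le_star_iff:
  "\<lbrakk>x \<in> carrier A; y \<in> carrier A\<rbrakk> \<Longrightarrow> y \<preceq> rl_star A x \<longleftrightarrow> x \<otimes> y \<preceq> \<one> \<and> y \<otimes> x \<preceq> \<one>"
  using le_lneg_iff[of x y] le_rneg_iff[of x y] le_trans[of y "lneg A x" "rneg A x"]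
    le_trans[of y "rneg A x" "lneg A x"] not_le[of "lneg A x" "rneg A x"]
  by (auto simp: rl_star_def wedge_eq)

lemma circ_closed [simp]: "x \<in> carrier A \<Longrightarrow> circ A x \<in> carrier A"
  by (simp add: circ_def vee_closed)

lemma le_circ_iff:
  "\<lbrakk>x \<in> carrier A; y \<in> carrier A\<rbrakk> \<Longrightarrow> y \<preceq> circ A x \<longleftrightarrow> x \<otimes> y \<preceq> \<one> \<or> y \<otimes> x \<preceq> \<one>"
  using le_lneg_iff[of x y] le_rneg_iff[of x y] le_trans[of y "lneg A x" "rneg A x"]
    le_trans[of y "rneg A x" "lneg A x"] not_le[of "lneg A x" "rneg A x"]
  by (auto simp: circ_def vee_eq)

lemma star_one [simp]: "rl_star A \<one> = \<one>"
  by (simp add: rl_star_def wedge_eq)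

lemma circ_one [simp]: "circ A \<one> = \<one>"
  by (simp add: circ_def vee_eq)

lemma star_le_circ: "x \<in> carrier A \<Longrightarrow> rl_star A x \<preceq> circ A x"
  by (simp add: le_circ_iff) (metis le_refl le_star_iff star_closed)

lemma star_antimono:
  "\<lbrakk>x \<preceq> y; x \<in> carrier A; y \<in> carrier A\<rbrakk> \<Longrightarrow> rl_star A y \<preceq> rl_star A x"
  by (meson le_refl le_star_iff le_trans m_closed mult_left_mono mult_right_mono one_closed star_closed)

lemma noncomm_cases:
  assumes "x \<in> carrier A" "y \<in> carrier A" "x \<otimes> y \<noteq> y \<otimes> x"
  obtains "x \<preceq> \<one>" "\<one> \<preceq> y" | "\<one> \<preceq> x" "y \<preceq> \<one>"
  using assms pos_mult[of x y] neg_mult[of x y] pos_mult[of y x] neg_mult[of y x] not_le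
    le_antisym one_closed by metis

text \<open>Elements of the same sign commute, so two elements failing to commute with \<open>x\<close> commute with
  each other; since products lie among their factors, associativity then forces them to agree.\<close>

lemma noncomm_unique:
  assumes c: "x \<in> carrier A" "y \<in> carrier A" "y' \<in> carrier A"
    and n: "x \<otimes> y \<noteq> y \<otimes> x" "x \<otimes> y' \<noteq> y' \<otimes> x"
  shows "y = y'"
proof -
  have comm: "y \<otimes> y' = y' \<otimes> y"
  proof -
    have "x \<noteq> \<one>"
      using n c by auto
    then have "(\<one> \<preceq> y \<and> \<one> \<preceq> y') \<or> (y \<preceq> \<one> \<and> y' \<preceq> \<one>)"
      using c n le_antisym by (metis noncomm_cases one_closed)
    then show ?thesis
      using c n by (metis le_antisym neg_mult not_le pos_mult)
  qed
  \<comment> \<open>Each non-commuting pair multiplies like a left-zero or a right-zero band. With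
    \<open>y\<close> and \<open>y'\<close> commuting, every combination of the two kinds violates
    one of the six associativity instances unless \<open>y = y'\<close>.\<close>
  have xy: "(x \<otimes> y = x \<and> y \<otimes> x = y) \<or> (x \<otimes> y = y \<and> y \<otimes> x = x)"
    and xy': "(x \<otimes> y' = x \<and> y' \<otimes> x = y') \<or> (x \<otimes> y' = y' \<and> y' \<otimes> x = x)"
    using c n mult_cases by metis+
  have ne: "x \<noteq> y" "x \<noteq> y'"
    using n by auto
  show ?thesis
    using xy xy' comm ne mult_cases[of y y'] m_assoc[of x y y'] m_assoc[of x y' y]
      m_assoc[of y y' x] m_assoc[of y' y x] m_assoc[of y x y'] m_assoc[of y' x y] c
    by metis
qed

text \<open>By \<open>le_circ_iff\<close> one product of \<open>x\<close> with
  \<open>circ A x\<close> is negative. If both were, \<open>circ A x\<close> would lie below the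
  star and hence equal it.\<close>

lemma noncomm_circ:
  assumes "x \<in> carrier A" "circ A x \<noteq> rl_star A x"
  shows "x \<otimes> circ A x \<noteq> circ A x \<otimes> x"
  using assms le_circ_iff[of x "circ A x"] le_star_iff[of x "circ A x"] le_refl star_le_circ le_antisym
  by (metis circ_closed star_closed)

lemma circ_eq_of_noncomm:
  assumes "x \<in> carrier A" "y \<in> carrier A" "x \<otimes> y \<noteq> y \<otimes> x"
  shows "circ A x = y" "circ A x \<noteq> rl_star A x"
proof -
  \<comment> \<open>If both products were below 1, or neither, both would be the meet or both the
    join, and they would agree.\<close>
  have "x \<otimes> y \<preceq> \<one> \<longleftrightarrow> \<not> y \<otimes> x \<preceq> \<one>"
    using assms mult_eq[of x y] mult_eq[of y x] wedge_comm vee_comm by metis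
  then have y: "y \<preceq> circ A x" "\<not> y \<preceq> rl_star A x"
    using assms by (auto simp: le_circ_iff le_star_iff)
  then show ne: "circ A x \<noteq> rl_star A x"
    by auto
  then have "x \<otimes> circ A x \<noteq> circ A x \<otimes> x"
    using noncomm_circ assms(1) by blast
  then show "circ A x = y"
    using noncomm_unique assms circ_closed by blast
qed

text \<open>Non-commutation is symmetric, so \<open>x\<close> is the unique element that fails to
  commute with \<open>circ A x\<close>.\<close>

lemma circ_circ:
  assumes "x \<in> carrier A" "circ A x \<noteq> rl_star A x"
  shows "circ A (circ A x) = x"
  using assms noncomm_circ circ_eq_of_noncomm(1) circ_closed by metis

end

section \<open>Components\<close>

lemma subuniverse_Inter:
  assumes "\<S> \<noteq> {}" "\<And>S. S \<in> \<S> \<Longrightarrow> subuniverse A S"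
  shows "subuniverse A (\<Inter>\<S>)"
  using assms unfolding subuniverse_def by (intro conjI ballI) blast+

lemma (in residuated_lattice) subuniverse_carrier: "subuniverse A (carrier A)"
  by (simp add: subuniverse_def wedge_closed vee_closed lres_closed rres_closed)

lemma (in residuated_lattice) subuniverse_hull:
  assumes "X \<subseteq> carrier A"
  shows "subuniverse A (subuniverse A hull X)"
  unfolding hull_def using assms subuniverse_carrier by (intro subuniverse_Inter) auto

context residuated_lattice
begin

lemma subuniverse_residuated_lattice:
  assumes "subuniverse A S"
  shows "residuated_lattice (A\<lparr>carrier := S\<rparr>)"
proof -
  have S: "S \<subseteq> carrier A"
    using assms by (simp add: subuniverse_def)
  have le: "rl_le (A\<lparr>carrier := S\<rparr>) = rl_le A"
    by (simp add: rl_le_def fun_eq_iff)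
  show ?thesis
    by unfold_locales
      (use assms S in \<open>auto simp: subuniverse_def le subset_iff m_assoc
        wedge_assoc vee_assoc wedge_absorb vee_absorb lres_residual rres_residual
        intro: wedge_comm vee_comm\<close>)
qed

lemma subuniverse_rneg: "\<lbrakk>subuniverse A S; x \<in> S\<rbrakk> \<Longrightarrow> rneg A x \<in> S"
  by (simp add: subuniverse_def rneg_def)

lemma subuniverse_lneg: "\<lbrakk>subuniverse A S; x \<in> S\<rbrakk> \<Longrightarrow> lneg A x \<in> S"
  by (simp add: subuniverse_def lneg_def)

lemma subuniverse_star: "\<lbrakk>subuniverse A S; x \<in> S\<rbrakk> \<Longrightarrow> rl_star A x \<in> S"
  using subuniverse_lneg subuniverse_rneg by (simp add: rl_star_def subuniverse_def)

lemma subuniverse_circ: "\<lbrakk>subuniverse A S; x \<in> S\<rbrakk> \<Longrightarrow> circ A x \<in> S"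
  using subuniverse_lneg subuniverse_rneg by (simp add: circ_def subuniverse_def)

end

text \<open>In an idempotent residuated chain this is the strict part of the monoidal preorder:
  \<open>y \<otimes> x\<close> is \<open>x\<close> or \<open>y\<close>, so for distinct elements the
  second equation says that \<open>y \<otimes> x = y\<close> fails.\<close>

definition below :: "('a, 'm) rl_scheme \<Rightarrow> 'a \<Rightarrow> 'a \<Rightarrow> bool" where
  "below A x y \<longleftrightarrow> x \<otimes>\<^bsub>A\<^esub> y = x \<and> y \<otimes>\<^bsub>A\<^esub> x = x \<and> x \<noteq> y"

context idempotent_residuated_chain
begin

lemma subuniverse_irc:
  assumes "subuniverse A S"
  shows "idempotent_residuated_chain (A\<lparr>carrier := S\<rparr>)"
proof -
  interpret S: residuated_lattice "A\<lparr>carrier := S\<rparr>"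
    using assms by (rule subuniverse_residuated_lattice)
  have S: "S \<subseteq> carrier A"
    using assms by (simp add: subuniverse_def)
  have le: "rl_le (A\<lparr>carrier := S\<rparr>) = rl_le A"
    by (simp add: rl_le_def fun_eq_iff)
  show ?thesis
    by unfold_locales (use S le_total idem in \<open>auto simp: le subset_iff\<close>)
qed

text \<open>Star and \<open>circ\<close> are the two negations in some order, products, meets and
  joins return one of their arguments, and \<open>lres_eq\<close>, \<open>rres_eq\<close> supply the
  residuals. Generation thus reduces to two unary maps.\<close>

lemma subuniverseI:
  assumes "S \<subseteq> carrier A" "\<one> \<in> S"
    and "\<And>x. x \<in> S \<Longrightarrow> rl_star A x \<in> S" "\<And>x. x \<in> S \<Longrightarrow> circ A x \<in> S"
  shows "subuniverse A S"
proof -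
  have "lneg A x \<in> S \<and> rneg A x \<in> S" if "x \<in> S" for x
    using assms(3,4)[OF that] assms(1) that
    by (auto simp: rl_star_def circ_def wedge_eq vee_eq subset_iff split: if_splits)
  then have "x \<otimes> y \<in> S \<and> wedge A x y \<in> S \<and> vee A x y \<in> S \<and> lres A x y \<in> S \<and> rres A x y \<in> S"
    if "x \<in> S" "y \<in> S" for x y
    using that assms(1) mult_cases[of x y]
    by (auto simp: wedge_eq vee_eq lres_eq rres_eq subset_iff)
  then show ?thesis
    using assms unfolding subuniverse_def by blast
qed

lemma below_trans:
  "\<lbrakk>below A x y; below A y z; x \<in> carrier A; y \<in> carrier A; z \<in> carrier A\<rbrakk> \<Longrightarrow> below A x z"
  unfolding below_def by (metis m_assoc)

lemma below_asym: "below A x y \<Longrightarrow> \<not> below A y x"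
  by (auto simp: below_def)

lemma below_total:
  "\<lbrakk>x \<otimes> y = y \<otimes> x; x \<noteq> y; x \<in> carrier A; y \<in> carrier A\<rbrakk> \<Longrightarrow> below A x y \<or> below A y x"
  using mult_cases[of x y] by (auto simp: below_def)

text \<open>The product is \<open>x\<close>; it is the meet if it is negative and the join
  otherwise. This is the order rule of nested sums.\<close>

lemma le_iff_of_below:
  assumes "below A x y" "x \<in> carrier A" "y \<in> carrier A"
  shows "x \<preceq> y \<longleftrightarrow> x \<preceq> \<one>"
proof
  assume "x \<preceq> \<one>"
  then show "x \<preceq> y"
    using assms mult_le_right[of x y] by (simp add: below_def)
next
  assume "x \<preceq> y"
  then show "x \<preceq> \<one>"
    using assms le_mult_right[of x y] le_antisym[of x y] by (auto simp: below_def)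
qed

lemma star_nonpos: "\<lbrakk>x \<in> carrier A; \<one> \<preceq> x\<rbrakk> \<Longrightarrow> rl_star A x \<preceq> \<one>"
  using star_antimono[of \<one> x] by simp

lemma star_nonneg: "\<lbrakk>x \<in> carrier A; x \<preceq> \<one>\<rbrakk> \<Longrightarrow> \<one> \<preceq> rl_star A x"
  using star_antimono[of x \<one>] by simp

lemma le_circ_commute:
  "\<lbrakk>x \<in> carrier A; y \<in> carrier A\<rbrakk> \<Longrightarrow> y \<preceq> circ A x \<longleftrightarrow> x \<preceq> circ A y"
  by (auto simp: le_circ_iff)

text \<open>Both products of \<open>x\<close> with its star are negative, hence equal to the meet,
  which is the star.\<close>

lemma star_below:
  assumes "x \<in> carrier A" "\<one> \<preceq> x" "x \<noteq> \<one>"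
  shows "below A (rl_star A x) x"
proof -
  have le: "rl_star A x \<preceq> \<one>"
    using assms star_nonpos by blast
  then have "rl_star A x \<preceq> x"
    using assms le_trans star_closed one_closed by blast
  moreover have "rl_star A x \<noteq> x"
    using assms le le_antisym by auto
  moreover have "x \<otimes> rl_star A x \<preceq> \<one>" "rl_star A x \<otimes> x \<preceq> \<one>"
    using le_star_iff[of x "rl_star A x"] assms by (simp_all add: le_refl)
  ultimately show ?thesis
    using assms mult_eq[of x "rl_star A x"] mult_eq[of "rl_star A x" x]
    by (simp add: below_def wedge_eq) (metis le_antisym star_closed)
qed

lemma below_le_star:
  assumes "below A x y" "x \<in> carrier A" "y \<in> carrier A" "x \<preceq> \<one>"
  shows "y \<preceq> rl_star A x"
  using assms by (simp add: le_star_iff below_def)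

end

section \<open>One-generated subalgebras and the preorder between them\<close>

context star_involutive_irc
begin

abbreviation gen where "gen x \<equiv> subuniverse A hull {x}"

lemma star_eq_one_iff: "x \<in> carrier A \<Longrightarrow> rl_star A x = \<one> \<longleftrightarrow> x = \<one>"
  using star_star star_one by metis

lemma star_le_star_iff:
  "\<lbrakk>x \<in> carrier A; y \<in> carrier A\<rbrakk> \<Longrightarrow> rl_star A x \<preceq> rl_star A y \<longleftrightarrow> y \<preceq> x"
  using star_antimono star_star star_closed by metis

lemma star_inj: "\<lbrakk>rl_star A x = rl_star A y; x \<in> carrier A; y \<in> carrier A\<rbrakk> \<Longrightarrow> x = y"
  using star_star by metis

lemma circ_eq_one_iff:
  assumes "x \<in> carrier A"
  shows "circ A x = \<one> \<longleftrightarrow> x = \<one>"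
  using assms circ_circ[of x] star_eq_one_iff[of x] circ_one by metis

lemma subuniverse_gen: "x \<in> carrier A \<Longrightarrow> subuniverse A (gen x)"
  by (simp add: subuniverse_hull)

lemma gen_self: "x \<in> gen x"
  by (simp add: hull_inc)

lemma gen_subset_carrier: "x \<in> carrier A \<Longrightarrow> gen x \<subseteq> carrier A"
  using subuniverse_gen by (simp add: subuniverse_def)

lemma gen_closed: "\<lbrakk>y \<in> gen x; x \<in> carrier A\<rbrakk> \<Longrightarrow> y \<in> carrier A"
  using gen_subset_carrier by blast

lemma one_in_gen: "x \<in> carrier A \<Longrightarrow> \<one> \<in> gen x"
  using subuniverse_gen by (simp add: subuniverse_def)

lemma star_in_gen: "\<lbrakk>y \<in> gen x; x \<in> carrier A\<rbrakk> \<Longrightarrow> rl_star A y \<in> gen x"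
  using subuniverse_gen subuniverse_star by blast

lemma circ_in_gen: "\<lbrakk>y \<in> gen x; x \<in> carrier A\<rbrakk> \<Longrightarrow> circ A y \<in> gen x"
  using subuniverse_gen subuniverse_circ by blast

lemma gen_mono: "\<lbrakk>y \<in> gen x; x \<in> carrier A\<rbrakk> \<Longrightarrow> gen y \<subseteq> gen x"
  using subuniverse_gen by (simp add: hull_minimal)

text \<open>\<open>subuniverseI\<close> turns generation into iteration of star and
  \<open>circ\<close>. The identity is split off because the intended properties, such as lying
  \<open>below\<close> a fixed element, fail for it.\<close>

lemma gen_induct [consumes 2, case_names self star circ]:
  assumes "y \<in> gen x" "x \<in> carrier A"
    and "P x"
    and "\<And>z. \<lbrakk>z \<in> gen x; z \<noteq> \<one>; P z\<rbrakk> \<Longrightarrow> P (rl_star A z)"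
    and "\<And>z. \<lbrakk>z \<in> gen x; z \<noteq> \<one>; P z\<rbrakk> \<Longrightarrow> P (circ A z)"
  shows "y = \<one> \<or> P y"
proof -
  have "rl_star A z = \<one> \<or> P (rl_star A z)" "circ A z = \<one> \<or> P (circ A z)"
    if "z \<in> gen x" "z = \<one> \<or> P z" for z
    using assms(4,5)[of z] that by (cases "z = \<one>"; simp)+
  then have "subuniverse A {z \<in> gen x. z = \<one> \<or> P z}"
    by (intro subuniverseI)
      (use assms gen_subset_carrier[OF assms(2)] in \<open>auto simp: one_in_gen star_in_gen circ_in_gen\<close>)
  then have "gen x \<subseteq> {z \<in> gen x. z = \<one> \<or> P z}"
    using assms(3) gen_self by (intro hull_minimal) auto
  then show ?thesis
    using assms(1) by blast
qed

text \<open>Every step leading from \<open>x\<close> to \<open>y\<close> can be undone: a star step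
  by \<open>star_star\<close>, a \<open>circ\<close> step by \<open>circ_circ\<close>, or by
  \<open>star_star\<close> where \<open>circ\<close> agrees with the star.\<close>

lemma gen_eq:
  assumes "y \<in> gen x" "y \<noteq> \<one>" "x \<in> carrier A"
  shows "gen y = gen x"
proof -
  have "y = \<one> \<or> x \<in> gen y"
    using assms(1,3)
  proof (induction rule: gen_induct)
    case self
    show ?case
      by (rule gen_self)
  next
    case (star z)
    have z: "z \<in> carrier A"
      using star gen_closed assms(3) by blast
    then have "z \<in> gen (rl_star A z)"
      using star_in_gen[OF gen_self, of "rl_star A z"] star_star by simp
    then show ?case
      using star gen_mono gen_closed assms(3) star_closed by blast
  next
    case (circ z)
    have z: "z \<in> carrier A"
      using circ gen_closed assms(3) by blast
    have "z = circ A (circ A z) \<or> z = rl_star A (circ A z)"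
      using circ_circ[OF z] star_star[OF z] by metis
    then have "z \<in> gen (circ A z)"
      using star_in_gen[OF gen_self, of "circ A z"] circ_in_gen[OF gen_self, of "circ A z"] z
      by auto
    then show ?case
      using circ gen_mono z circ_closed by blast
  qed
  then show ?thesis
    using assms gen_mono gen_closed by blast
qed

lemma gen_Int:
  assumes "x \<in> carrier A" "y \<in> carrier A" "gen x \<noteq> gen y"
  shows "gen x \<inter> gen y = {\<one>}"
  using assms gen_eq one_in_gen by blast

text \<open>The only possible partner is \<open>circ A x\<close>. Elements of different components
  therefore commute and are comparable by \<open>below\<close>.\<close>

lemma noncomm_in_gen:
  "\<lbrakk>x \<otimes> y \<noteq> y \<otimes> x; x \<in> carrier A; y \<in> carrier A\<rbrakk> \<Longrightarrow> y \<in> gen x"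
  using circ_eq_of_noncomm(1)[of x y] circ_in_gen[OF gen_self, of x] by simp

lemma below_total_gen:
  "\<lbrakk>y \<notin> gen x; x \<in> carrier A; y \<in> carrier A\<rbrakk> \<Longrightarrow> below A x y \<or> below A y x"
  using noncomm_in_gen below_total gen_self by metis

text \<open>Otherwise \<open>y\<close> would lie below the star of \<open>x\<close>. For positive
  \<open>x\<close> the star is \<open>below\<close> \<open>x\<close>, and transitivity puts
  \<open>y\<close> \<open>below\<close> \<open>x\<close>. For negative \<open>x\<close> also
  \<open>y\<close> is negative; \<open>x \<preceq> y\<close> holds by sign, and reflecting through
  the star gives \<open>y \<preceq> x\<close>.\<close>

lemma below_star:
  assumes b: "below A x y" and y: "y \<notin> gen x" and c: "x \<in> carrier A" "y \<in> carrier A"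
  shows "below A (rl_star A x) y"
proof (rule ccontr)
  assume n: "\<not> below A (rl_star A x) y"
  have x1: "x \<noteq> \<one>"
    using b c by (auto simp: below_def)
  have "y \<notin> gen (rl_star A x)"
    using y gen_eq[of "rl_star A x" x] gen_self star_in_gen star_eq_one_iff x1 c by metis
  then have yx: "below A y (rl_star A x)"
    using n below_total_gen[of y "rl_star A x"] c by simp
  show False
  proof (cases "x \<preceq> \<one>")
    case True
    then have le: "y \<preceq> rl_star A x"
      using below_le_star b c by blast
    then have "y \<preceq> \<one>"
      using le_iff_of_below yx c by simp
    then have "x = y"
      using le_iff_of_below[OF b c] below_le_star[OF yx] star_le_star_iff[of x y] le_antisym[of x y]
        True c by simp
    then show ?thesis
      using b by (simp add: below_def)
  next
    case False
    then have "below A (rl_star A x) x"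
      using star_below not_le x1 c by simp
    then have "below A y x"
      using yx below_trans c star_closed by blast
    then show ?thesis
      using b below_asym by blast
  qed
qed

lemma below_circ:
  assumes b: "below A x y" and y: "y \<notin> gen x" and c: "x \<in> carrier A" "y \<in> carrier A"
  shows "below A (circ A x) y"
proof (cases "circ A x = rl_star A x")
  case True
  then show ?thesis
    using below_star assms by simp
next
  case False
  have x1: "x \<noteq> \<one>"
    using b c by (auto simp: below_def)
  have ne: "circ A x \<noteq> y"
    using y circ_in_gen gen_self c by blast
  have "y \<notin> gen (circ A x)"
    using y gen_eq[of "circ A x" x] gen_self circ_in_gen circ_eq_one_iff x1 c by metis
  moreover have "\<not> below A y (circ A x)"
  proof
    assume yx: "below A y (circ A x)"
    \<comment> \<open>One side absorbs \<open>x\<close> into \<open>circ A x\<close>. Replacing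
      \<open>x\<close> there by \<open>y \<otimes> x\<close> or \<open>x \<otimes> y\<close> would
      collapse \<open>circ A x\<close> to \<open>y\<close>.\<close>
    have "x \<otimes> circ A x = circ A x \<or> circ A x \<otimes> x = circ A x"
      using noncomm_circ[OF c(1) False] mult_cases[of x "circ A x"] mult_cases[of "circ A x" x] c
      by auto
    then show False
    proof
      assume h: "x \<otimes> circ A x = circ A x"
      then have "circ A x = (y \<otimes> x) \<otimes> circ A x"
        using b by (simp add: below_def)
      also have "\<dots> = y"
        using h yx c by (simp add: m_assoc below_def)
      finally show False
        using ne by simp
    next
      assume h: "circ A x \<otimes> x = circ A x"
      then have "circ A x = circ A x \<otimes> (x \<otimes> y)"
        using b by (simp add: below_def)
      also have "\<dots> = y"
        using h yx c by (simp flip: m_assoc add: below_def)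
      finally show False
        using ne by simp
    qed
  qed
  ultimately show ?thesis
    using below_total_gen c circ_closed by blast
qed

lemma below_gen_left:
  assumes "below A x y" "y \<notin> gen x" "x \<in> carrier A" "y \<in> carrier A" "z \<in> gen x" "z \<noteq> \<one>"
  shows "below A z y"
proof -
  have ny: "y \<notin> gen z" if "z \<in> gen x" "z \<noteq> \<one>" for z
    using gen_eq that assms by metis
  have "z = \<one> \<or> below A z y"
    using assms(5,3)
    by (induction rule: gen_induct)
      (use assms ny below_star below_circ gen_closed in blast)+
  then show ?thesis
    using assms by blast
qed

text \<open>The two components are traversed one at a time. If \<open>w\<close> were
  \<open>below\<close> \<open>z\<close>, moving \<open>w\<close> back to \<open>y\<close> inside its
  component would reverse the relation between \<open>z\<close> and \<open>y\<close> already
  obtained.\<close>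

lemma below_gen:
  assumes b: "below A x y" and y: "y \<notin> gen x" "y \<noteq> \<one>" and c: "x \<in> carrier A" "y \<in> carrier A"
    and z: "z \<in> gen x" "z \<noteq> \<one>" and w: "w \<in> gen y" "w \<noteq> \<one>"
  shows "below A z w"
proof -
  have zy: "below A z y"
    using below_gen_left assms by blast
  have zw: "w \<in> carrier A" "z \<in> carrier A" "gen w = gen y" "gen z = gen x"
    using assms gen_closed gen_eq by blast+
  have ne: "z \<notin> gen w" "w \<notin> gen z"
    using zw assms gen_eq gen_self by metis+
  have "\<not> below A w z"
    using below_gen_left[of w z y] ne zw zy y c gen_self below_asym by metis
  then show ?thesis
    using below_total_gen zw ne by blast
qed

end

section \<open>Crowns indexed by intervals of integers\<close>

lemma epreorder_iso_sym:
  assumes "epreorder_iso P Q f"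
  shows "epreorder_iso Q P (inv_into (pts P) f)"
proof -
  have bij: "bij_betw f (pts P) (pts Q)"
    using assms by (simp add: epreorder_iso_def)
  have "inv_into (pts P) f y \<in> pts P \<and> f (inv_into (pts P) f y) = y" if "y \<in> pts Q" for y
    using bij that by (metis bij_betw_imp_surj_on f_inv_into_f inv_into_into)
  then show ?thesis
    using assms bij_betw_inv_into[OF bij] unfolding epreorder_iso_def by metis
qed

lemma epreorder_iso_trans:
  assumes "epreorder_iso P Q f" "epreorder_iso Q R g"
  shows "epreorder_iso P R (g \<circ> f)"
proof -
  have "f x \<in> pts Q" if "x \<in> pts P" for x
    using assms(1) that by (auto simp: epreorder_iso_def dest: bij_betwE)
  then show ?thesis
    using assms bij_betw_trans unfolding epreorder_iso_def by force
qed

definition crown_iso :: "('p + unit) epreorder \<Rightarrow> ('q + unit) epreorder \<Rightarrow> bool" where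
  "crown_iso C D \<longleftrightarrow> (\<exists>f. epreorder_iso C D f \<and> f (Inr ()) = Inr ())"

lemma crown_iso_sym:
  assumes "crown_iso C D" "Inr () \<in> pts C"
  shows "crown_iso D C"
proof -
  obtain f where f: "epreorder_iso C D f" "f (Inr ()) = Inr ()"
    using assms by (auto simp: crown_iso_def)
  then have "inv_into (pts C) f (Inr ()) = Inr ()"
    using assms(2) by (metis bij_betw_def epreorder_iso_def inv_into_f_f)
  then show ?thesis
    using epreorder_iso_sym[OF f(1)] by (auto simp: crown_iso_def)
qed

lemma has_crown_trans:
  assumes "has_crown A C" "crown_iso C D"
  shows "has_crown A D"
proof -
  obtain f g where "epreorder_iso (rl_epreorder A) C f" "f \<one>\<^bsub>A\<^esub> = Inr ()"
    "epreorder_iso C D g" "g (Inr ()) = Inr ()"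
    using assms by (auto simp: has_crown_def crown_iso_def)
  then have "epreorder_iso (rl_epreorder A) D (g \<circ> f)" "(g \<circ> f) \<one>\<^bsub>A\<^esub> = Inr ()"
    using epreorder_iso_trans by auto
  then show ?thesis
    unfolding has_crown_def by blast
qed

text \<open>Every vertical crown is, up to a relabelling of the indices, the part of a crown over
  \<open>\<int>\<close> cut out by an interval \<open>J\<close>. The negative point of index \<open>i\<close> goes together with the positive
  point of index \<open>i + 1\<close>, because these two points are swapped by the star operation.\<close>

definition zcrown :: "int set \<Rightarrow> int set \<Rightarrow> (int \<times> two + unit) epreorder" where
  "zcrown J L = (crown_Z L)
     \<lparr>pts := insert (Inr ()) (Inl ` {(i, t). (case t of pt_a \<Rightarrow> i | pt_b \<Rightarrow> i + 1) \<in> J})\<rparr>"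

lemma sqle_ordinal_plus [simp]:
  "sqle (ordinal_plus P Q) (Inl p) (Inl p') = sqle P p p'"
  "sqle (ordinal_plus P Q) (Inl p) (Inr q) = True"
  "sqle (ordinal_plus P Q) (Inr q) (Inl p) = False"
  "sqle (ordinal_plus P Q) (Inr q) (Inr q') = sqle Q q q'"
  by (simp_all add: ordinal_plus_def)

lemma parts_ordinal_plus [simp]:
  "pts (ordinal_plus P Q) = pts P <+> pts Q"
  "pos (ordinal_plus P Q) = pos P <+> pos Q"
  "neg (ordinal_plus P Q) = neg P <+> neg Q"
  by (simp_all add: ordinal_plus_def)

lemma parts_one [simp]:
  "pts one_L = UNIV" "pos one_L = UNIV" "neg one_L = {}" "sqle one_L u v"
  "pts one_R = UNIV" "pos one_R = {}" "neg one_R = UNIV" "sqle one_R u v"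
  by (simp_all add: one_L_def one_R_def)

lemma parts_with_identity [simp]:
  "sqle (with_identity P) = sqle (ordinal_plus P one_L)"
  "pts (with_identity P) = pts P <+> UNIV"
  "pos (with_identity P) = pos P <+> UNIV"
  "neg (with_identity P) = insert (Inr ()) (neg P <+> {})"
  by (simp_all add: with_identity_def Let_def)

lemma sqle_pairs_sum [simp]:
  "sqle (pairs_sum I r L) (i, s) (j, t) \<longleftrightarrow> (i \<noteq> j \<and> (i, j) \<in> r) \<or> (i = j \<and> (i \<in> L \<or> s = t))"
  by (simp add: pairs_sum_def ordinal_sum_def two_L_def two_R_def)

lemma parts_pairs_sum [simp]:
  "pts (pairs_sum I r L) = I \<times> UNIV"
  "pos (pairs_sum I r L) = I \<times> {pt_a}"
  "neg (pairs_sum I r L) = I \<times> {pt_b}"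
  by (auto simp: pairs_sum_def ordinal_sum_def two_L_def two_R_def split: if_splits)

lemma sqle_zcrown [simp]:
  "sqle (zcrown J L) (Inl (i, s)) (Inl (j, t)) \<longleftrightarrow> i < j \<or> (i = j \<and> (i \<in> L \<or> s = t))"
  "sqle (zcrown J L) (Inl p) (Inr u)"
  "\<not> sqle (zcrown J L) (Inr u) (Inl p)"
  "sqle (zcrown J L) (Inr u) (Inr v)"
  by (auto simp: zcrown_def crown_Z_def)

text \<open>The signs are those of the whole crown over the integers and include points outside
  \<open>pts\<close>; \<open>epreorder_iso\<close> tests signs on \<open>pts\<close> only.\<close>

lemma parts_zcrown [simp]:
  "pts (zcrown J L) = insert (Inr ()) (Inl ` {(i, t). (case t of pt_a \<Rightarrow> i | pt_b \<Rightarrow> i + 1) \<in> J})"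
  "pos (zcrown J L) = insert (Inr ()) (Inl ` (UNIV \<times> {pt_a}))"
  "neg (zcrown J L) = insert (Inr ()) (Inl ` (UNIV \<times> {pt_b}))"
  by (auto simp: zcrown_def crown_Z_def)

lemma crown_Z_iso: "crown_iso (crown_Z L) (zcrown UNIV L)"
proof -
  have "pts (crown_Z L) = pts (zcrown UNIV L)"
    by (auto simp: crown_Z_def simp del: UNIV_Plus_UNIV)
  then show ?thesis
    unfolding crown_iso_def epreorder_iso_def by (intro exI[of _ id]) (auto simp: zcrown_def)
qed

lemma zcrown_shift: "crown_iso (zcrown J L) (zcrown ((+) k ` J) ((+) k ` L))"
proof -
  have sh: "i \<in> (+) k ` X \<longleftrightarrow> i - k \<in> X" for i X
    by (force simp: image_iff)
  have "bij_betw (map_sum (\<lambda>(i, t). (k + i, t)) id) (pts (zcrown J L))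
      (pts (zcrown ((+) k ` J) ((+) k ` L)))"
    by (rule bij_betw_byWitness[where f' = "map_sum (\<lambda>(i, t). (i - k, t)) id"])
      (auto simp: sh algebra_simps split: two.splits)
  then show ?thesis
    unfolding crown_iso_def epreorder_iso_def
    by (intro exI[of _ "map_sum (\<lambda>(i, t). (k + i, t)) id"]) auto
qed

lemma crown_N_iso:
  assumes "\<And>n. n \<in> M \<longleftrightarrow> int n \<in> L"
  shows "crown_iso (crown_N M) (zcrown {0..} L)"
proof -
  \<comment> \<open>Over \<open>{0..}\<close> the negative points start at index -1, one step before
    the positive ones; the unpaired point \<open>(- 1, pt_b)\<close> is the summand
    \<open>one_R\<close>.\<close>
  let ?f = "map_sum (case_sum (\<lambda>_. (- 1, pt_b)) (\<lambda>(n, t). (int n, t))) id"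
  let ?g = "map_sum (\<lambda>(i, t). if i = - 1 then Inl () else Inr (nat i, t)) id"
  have "bij_betw ?f (pts (crown_N M)) (pts (zcrown {0..} L))"
    by (rule bij_betw_byWitness[where f' = ?g]) (auto simp: crown_N_def simp del: UNIV_Plus_UNIV split: two.splits)
  then show ?thesis
    unfolding crown_iso_def epreorder_iso_def
    by (intro exI[of _ ?f]) (auto simp: crown_N_def assms simp del: UNIV_Plus_UNIV)
qed

lemma crown_N_dual_iso:
  assumes "\<And>n. n \<in> M \<longleftrightarrow> - int n - 1 \<in> L"
  shows "crown_iso (crown_N_dual M) (zcrown {..0} L)"
proof -
  \<comment> \<open>Over \<open>{..0}\<close> the negative points stop at index -1, so the pairs
    have indices \<open>- n - 1\<close> and \<open>(0, pt_a)\<close> is the unpaired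
    \<open>one_L\<close>.\<close>
  let ?f = "map_sum (case_sum (\<lambda>(n, t). (- int n - 1, t)) (\<lambda>_. (0, pt_a))) id"
  let ?g = "map_sum (\<lambda>(i, t). if i = 0 then Inr () else Inl (nat (- i - 1), t)) id"
  have "bij_betw ?f (pts (crown_N_dual M)) (pts (zcrown {..0} L))"
    by (rule bij_betw_byWitness[where f' = ?g]) (auto simp: crown_N_dual_def simp del: UNIV_Plus_UNIV split: two.splits)
  then show ?thesis
    unfolding crown_iso_def epreorder_iso_def
    by (intro exI[of _ ?f]) (auto simp: crown_N_dual_def assms simp del: UNIV_Plus_UNIV)
qed

lemma crown_fin_iso:
  assumes "\<And>k. k \<in> {1..n} \<Longrightarrow> k \<in> M \<longleftrightarrow> int k \<in> L"
  shows "crown_iso (crown_fin n M) (zcrown {1..int n + 1} L)"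
proof -
  \<comment> \<open>Positive points have indices 1 to n + 1 and negative ones 0 to n. The pairs are
    those from 1 to n, with one unpaired point at each end.\<close>
  let ?f = "map_sum (case_sum (case_sum (\<lambda>_. (0, pt_b)) (\<lambda>(k, t). (int k, t)))
      (\<lambda>_. (int n + 1, pt_a))) id"
  let ?g = "map_sum (\<lambda>(i, t). if i = 0 then Inl (Inl ()) else if i = int n + 1 then Inr ()
      else Inl (Inr (nat i, t))) id"
  have "bij_betw ?f (pts (crown_fin n M)) (pts (zcrown {1..int n + 1} L))"
    by (rule bij_betw_byWitness[where f' = ?g])
      (auto simp: crown_fin_def nat_le_iff simp del: UNIV_Plus_UNIV split: two.splits;
        metis two.exhaust)+
  then show ?thesis
    unfolding crown_iso_def epreorder_iso_def
    by (intro exI[of _ ?f]) (auto simp: crown_fin_def assms simp del: UNIV_Plus_UNIV)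
qed

lemma crownian_imp_zcrown:
  assumes "crownian A"
  shows "\<exists>J L. has_crown A (zcrown J L)"
proof -
  consider L where "has_crown A (crown_Z L)" | L where "has_crown A (crown_N L)"
    | L where "has_crown A (crown_N_dual L)" | n L where "has_crown A (crown_fin n L)"
    using assms by (auto simp: crownian_def)
  then show ?thesis
  proof cases
    case 1
    then show ?thesis
      using has_crown_trans crown_Z_iso by blast
  next
    case (2 L)
    have "n \<in> L \<longleftrightarrow> int n \<in> int ` L" for n
      by auto
    then show ?thesis
      using 2 has_crown_trans crown_N_iso by blast
  next
    case (3 L)
    have "n \<in> L \<longleftrightarrow> - int n - 1 \<in> (\<lambda>n. - int n - 1) ` L" for n
      by auto
    then show ?thesis
      using 3 has_crown_trans crown_N_dual_iso by blast
  next
    case (4 n L)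
    have "crown_iso (crown_fin n L) (zcrown {1..int n + 1} (int ` L))"
      by (rule crown_fin_iso) auto
    then show ?thesis
      using 4 has_crown_trans by blast
  qed
qed

section \<open>Convex sets of integers and the four shapes of crowns\<close>

lemma int_set_has_least:
  fixes J :: "int set"
  assumes "j \<in> J" "\<And>i. i \<in> J \<Longrightarrow> b \<le> i"
  obtains m where "m \<in> J" "\<And>i. i \<in> J \<Longrightarrow> m \<le> i"
proof -
  obtain m where m: "m \<in> J" "\<And>i. i \<in> J \<Longrightarrow> nat (m - b) \<le> nat (i - b)"
    using ex_has_least_nat[of "\<lambda>i. i \<in> J" j "\<lambda>i. nat (i - b)"] assms(1) by auto
  have "m \<le> i" if "i \<in> J" for i
    using m(2)[OF that] assms(2)[OF that] by linarith
  then show ?thesis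
    using m(1) that by blast
qed

lemma int_set_has_greatest:
  fixes J :: "int set"
  assumes "j \<in> J" "\<And>i. i \<in> J \<Longrightarrow> i \<le> b"
  obtains m where "m \<in> J" "\<And>i. i \<in> J \<Longrightarrow> i \<le> m"
proof -
  obtain m where m: "m \<in> J" "\<And>i. i \<in> J \<Longrightarrow> nat (b - m) \<le> nat (b - i)"
    using ex_has_least_nat[of "\<lambda>i. i \<in> J" j "\<lambda>i. nat (b - i)"] assms(1) by auto
  have "i \<le> m" if "i \<in> J" for i
    using m(2)[OF that] assms(2)[OF that] by linarith
  then show ?thesis
    using m(1) that by blast
qed

lemma int_interval_cases:
  fixes J :: "int set"
  assumes "j \<in> J" and conv: "\<And>i k l. \<lbrakk>i \<in> J; l \<in> J; i \<le> k; k \<le> l\<rbrakk> \<Longrightarrow> k \<in> J"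
  obtains "J = UNIV" | m where "J = {m..}" | m where "J = {..m}" | m l where "m \<le> l" "J = {m..l}"
proof (cases "\<exists>b. \<forall>i\<in>J. b \<le> i")
  case True
  then obtain m where m: "m \<in> J" "\<And>i. i \<in> J \<Longrightarrow> m \<le> i"
    using int_set_has_least assms(1) by metis
  show ?thesis
  proof (cases "\<exists>b. \<forall>i\<in>J. i \<le> b")
    case True
    then obtain l where l: "l \<in> J" "\<And>i. i \<in> J \<Longrightarrow> i \<le> l"
      using int_set_has_greatest assms(1) by metis
    have "k \<in> J" if "m \<le> k" "k \<le> l" for k
      using conv[OF m(1) l(1) that] .
    then have "J = {m..l}"
      using m(2) l(2) unfolding set_eq_iff atLeastAtMost_iff by blast
    moreover have "m \<le> l"
      using m l by blast
    ultimately show ?thesis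
      using that by blast
  next
    case False
    have "k \<in> J" if k: "m \<le> k" for k
    proof -
      obtain l where "l \<in> J" "\<not> l \<le> k"
        using False by blast
      then show ?thesis
        using conv[of m l k] m k by simp
    qed
    then have "J = {m..}"
      using m unfolding set_eq_iff atLeast_iff by blast
    then show ?thesis
      using that by blast
  qed
next
  case nb: False
  show ?thesis
  proof (cases "\<exists>b. \<forall>i\<in>J. i \<le> b")
    case True
    then obtain l where l: "l \<in> J" "\<And>i. i \<in> J \<Longrightarrow> i \<le> l"
      using int_set_has_greatest assms(1) by metis
    have "k \<in> J" if k: "k \<le> l" for k
    proof -
      obtain i where "i \<in> J" "\<not> k \<le> i"
        using nb by blast
      then show ?thesis
        using conv[of i l k] l k by simp
    qed
    then have "J = {..l}"
      using l unfolding set_eq_iff atMost_iff by blast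
    then show ?thesis
      using that by blast
  next
    case False
    have "k \<in> J" for k
    proof -
      obtain i l where "i \<in> J" "\<not> k \<le> i" "l \<in> J" "\<not> l \<le> k"
        using nb False by meson
      then show ?thesis
        using conv[of i l k] by simp
    qed
    then show ?thesis
      using that(1) by blast
  qed
qed

lemma crownianI:
  assumes irc: "idempotent_residuated_chain A" and A: "has_crown A (zcrown J L)"
    and J: "j \<in> J" "\<And>i k l. \<lbrakk>i \<in> J; l \<in> J; i \<le> k; k \<le> l\<rbrakk> \<Longrightarrow> k \<in> J"
  shows "crownian A"
proof -
  have shift: "has_crown A (zcrown ((+) k ` J) ((+) k ` L))" for k
    using A zcrown_shift has_crown_trans by blast
  consider "J = UNIV" | m where "J = {m..}" | m where "J = {..m}" | m l where "m \<le> l" "J = {m..l}"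
    by (rule int_interval_cases[OF J])
  then show ?thesis
  proof cases
    case 1
    then have "has_crown A (crown_Z L)"
      using A has_crown_trans crown_iso_sym[OF crown_Z_iso] by (fastforce simp: crown_Z_def)
    then show ?thesis
      using irc unfolding crownian_def by blast
  next
    case (2 m)
    then have "(+) (- m) ` J = {0..}"
      by (simp only: image_add_atLeast) simp
    then have "has_crown A (zcrown {0..} ((+) (- m) ` L))"
      using shift by metis
    moreover have "crown_iso (crown_N (int -` ((+) (- m) ` L))) (zcrown {0..} ((+) (- m) ` L))"
      by (rule crown_N_iso) simp
    ultimately have "has_crown A (crown_N (int -` ((+) (- m) ` L)))"
      using has_crown_trans crown_iso_sym by (fastforce simp: crown_N_def)
    then show ?thesis
      using irc unfolding crownian_def by blast
  next
    case (3 m)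
    then have "(+) (- m) ` J = {..0}"
      by (simp only: image_add_atMost) simp
    then have "has_crown A (zcrown {..0} ((+) (- m) ` L))"
      using shift by metis
    moreover have "crown_iso (crown_N_dual ((\<lambda>n. - int n - 1) -` ((+) (- m) ` L)))
        (zcrown {..0} ((+) (- m) ` L))"
      by (rule crown_N_dual_iso) simp
    ultimately have "has_crown A (crown_N_dual ((\<lambda>n. - int n - 1) -` ((+) (- m) ` L)))"
      using has_crown_trans crown_iso_sym by (fastforce simp: crown_N_dual_def)
    then show ?thesis
      using irc unfolding crownian_def by blast
  next
    case (4 m l)
    let ?L = "(+) (1 - m) ` L" and ?n = "nat (l - m)"
    \<comment> \<open>An interval of n + 1 integers has n complete pairs. The cut to
      \<open>{1..?n}\<close> meets the demand of \<open>crownian\<close> on \<open>L\<close> and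
      changes no pair.\<close>
    let ?M = "{1..?n} \<inter> int -` ?L"
    have "(+) (1 - m) ` J = {1..int ?n + 1}"
      using 4(1) unfolding 4(2) image_add_atLeastAtMost by simp
    then have "has_crown A (zcrown {1..int ?n + 1} ?L)"
      using shift by metis
    moreover have "crown_iso (crown_fin ?n ?M) (zcrown {1..int ?n + 1} ?L)"
      by (rule crown_fin_iso) simp
    ultimately have "has_crown A (crown_fin ?n ?M)"
      using has_crown_trans crown_iso_sym by (fastforce simp: crown_fin_def)
    then show ?thesis
      using irc unfolding crownian_def by blast
  qed
qed

text \<open>The star of a positive point is the negative point just beneath it in the monoidal
  preorder, and conversely. A different value would lie strictly between two adjacent
  points.\<close>

lemma crownian_star_involutive:
  fixes A :: "('a, 'm) rl_scheme" (structure)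
  assumes "crownian A"
  shows "star_involutive_irc A"
proof -
  interpret idempotent_residuated_chain A
    using assms by (simp add: crownian_def)
  obtain J L f where f: "epreorder_iso (rl_epreorder A) (zcrown J L) f" and f1: "f \<one> = Inr ()"
    using crownian_imp_zcrown[OF assms] by (auto simp: has_crown_def)
  have inj: "inj_on f (carrier A)" and surj: "f ` carrier A = pts (zcrown J L)"
    using f by (simp_all add: epreorder_iso_def rl_epreorder_def bij_betw_def)
  have sq: "x \<otimes> y = x \<longleftrightarrow> sqle (zcrown J L) (f x) (f y)" if "x \<in> carrier A" "y \<in> carrier A" for x y
    using f that by (simp add: epreorder_iso_def rl_epreorder_def)
  have sgn: "\<one> \<preceq> x \<longleftrightarrow> f x \<in> pos (zcrown J L)" "x \<preceq> \<one> \<longleftrightarrow> f x \<in> neg (zcrown J L)"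
    if "x \<in> carrier A" for x
    using f that by (simp_all add: epreorder_iso_def rl_epreorder_def)
  have pair: "rl_star A a = b \<and> rl_star A b = a"
    if "a \<in> carrier A" "b \<in> carrier A" "f a = Inl (i + 1, pt_a)" "f b = Inl (i, pt_b)" for a b i
  proof
    note c = that(1,2) and fab = that(3,4)
    have ba: "b \<otimes> a \<preceq> \<one>" and ab: "a \<otimes> b \<preceq> \<one>"
      using sq[of b a] sq[of a b] sgn[of a] sgn[of b] mult_cases[of a b] that by auto
    have sb: "\<one> \<preceq> a" "a \<noteq> \<one>" "b \<preceq> \<one>" "b \<noteq> \<one>"
      using sgn that f1 by auto
    \<comment> \<open>Only the identity is left as a candidate: no index lies between
      \<open>i\<close> and \<open>i + 1\<close>, and the points of one pair are equivalent or
      incomparable, never strictly ordered.\<close>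
    have between: "c = \<one>"
      if c': "c \<in> carrier A" "c \<noteq> a" "c \<noteq> b" "b \<otimes> c = b" "c \<otimes> b = b" "c \<otimes> a = c" "a \<otimes> c = c" for c
    proof (rule ccontr)
      assume "c \<noteq> \<one>"
      then have "f c \<noteq> Inr ()"
        using c'(1) f1 inj by (metis inj_on_eq_iff one_closed)
      then obtain j t where "f c = Inl (j, t)"
        by (metis old.unit.exhaust sumE surj_pair)
      then show False
        using sq[of b c] sq[of c b] sq[of c a] sq[of a c] c' c fab by auto
    qed
    show "rl_star A a = b"
    proof (rule ccontr)
      assume ne: "rl_star A a \<noteq> b"
      let ?c = "rl_star A a"
      have le: "b \<preceq> ?c" "?c \<preceq> \<one>"
        using le_star_iff c ab ba star_nonpos sb by auto
      have "below A ?c a"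
        using star_below c sb by blast
      moreover have "b \<otimes> ?c = b" "?c \<otimes> b = b"
        using neg_mult[of b ?c] neg_mult[of ?c b] le sb c le_antisym[of b ?c] by auto
      ultimately have "?c = \<one>"
        using between[of ?c] c ne by (auto simp: below_def)
      then show False
        using le_star_iff[of a \<one>] c sb le_antisym[of a \<one>] by (simp add: le_refl)
    qed
    show "rl_star A b = a"
    proof (rule ccontr)
      assume ne: "rl_star A b \<noteq> a"
      let ?c = "rl_star A b"
      have le: "a \<preceq> ?c" "\<one> \<preceq> ?c"
        using le_star_iff c ab ba star_nonneg sb by auto
      have c1: "?c \<noteq> \<one>"
        using le c sb le_antisym[of a \<one>] by auto
      have "b \<otimes> ?c \<preceq> \<one>" "?c \<otimes> b \<preceq> \<one>"
        using le_star_iff[of b ?c] c le_refl by auto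
      then have "b \<otimes> ?c = b" "?c \<otimes> b = b"
        using mult_eq_neg_pos[of b ?c] mult_eq_pos_neg[of ?c b] le sb c by auto
      moreover have "a \<otimes> ?c = ?c" "?c \<otimes> a = ?c"
        using pos_mult[of a ?c] pos_mult[of ?c a] le sb c le_antisym[of a ?c] by auto
      moreover have "?c \<noteq> b"
        using le sb c le_antisym[of b \<one>] by auto
      ultimately show False
        using between[of ?c] c ne c1 by auto
    qed
  qed
  have "rl_star A (rl_star A x) = x" if x: "x \<in> carrier A" for x
  proof -
    have "f x \<in> pts (zcrown J L)"
      using x surj by blast
    then consider "f x = Inr ()" | i where "f x = Inl (i, pt_a)" "i \<in> J"
      | i where "f x = Inl (i, pt_b)" "i + 1 \<in> J"
      by (auto split: two.splits; metis two.exhaust)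
    then show ?thesis
    proof cases
      case 1
      then have "x = \<one>"
        using x f1 inj by (metis inj_on_eq_iff one_closed)
      then show ?thesis
        by simp
    next
      case (2 i)
      then have "Inl (i - 1, pt_b) \<in> f ` carrier A"
        unfolding surj by auto
      then obtain b where "b \<in> carrier A" "f b = Inl (i - 1, pt_b)"
        by auto
      then show ?thesis
        using pair[of x b "i - 1"] x 2 by simp
    next
      case (3 i)
      then have "Inl (i + 1, pt_a) \<in> f ` carrier A"
        unfolding surj by auto
      then obtain a where "a \<in> carrier A" "f a = Inl (i + 1, pt_a)"
        by auto
      then show ?thesis
        using pair[of a x i] x 3 by simp
    qed
  qed
  then show ?thesis
    by unfold_locales
qed

section \<open>Components are crowns\<close>

context star_involutive_irc
begin

text \<open>One \<open>circ\<close> step and one star step at a time keep positive elements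
  positive. The names follow the monoidal preorder; in the order of the chain, \<open>up x\<close>
  lies below \<open>x\<close>.\<close>

definition up where "up x = rl_star A (circ A x)"
definition down where "down x = circ A (rl_star A x)"

definition zig :: "'a \<Rightarrow> int \<Rightarrow> 'a" where
  "zig a i = (if 0 \<le> i then (up ^^ nat i) a else (down ^^ nat (- i)) a)"

lemma up_closed [simp]: "x \<in> carrier A \<Longrightarrow> up x \<in> carrier A"
  by (simp add: up_def)

lemma down_closed [simp]: "x \<in> carrier A \<Longrightarrow> down x \<in> carrier A"
  by (simp add: down_def)

lemma up_le: "x \<in> carrier A \<Longrightarrow> up x \<preceq> x"
  using star_antimono[OF star_le_circ] by (simp add: up_def star_star)

lemma le_down: "x \<in> carrier A \<Longrightarrow> x \<preceq> down x"
  using star_le_circ[of "rl_star A x"] by (simp add: down_def star_star)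

lemma up_pos:
  assumes "x \<in> carrier A" "\<one> \<preceq> x" "x \<noteq> \<one>"
  shows "\<one> \<preceq> up x \<and> up x \<noteq> \<one>"
proof -
  have "\<not> \<one> \<preceq> circ A x"
    using assms le_circ_commute[of x \<one>] le_antisym[of x \<one>] by auto
  then have "circ A x \<preceq> \<one>"
    using assms not_le by simp
  then show ?thesis
    using assms star_nonneg by (simp add: up_def star_eq_one_iff circ_eq_one_iff)
qed

lemma down_pos:
  assumes "x \<in> carrier A" "\<one> \<preceq> x" "x \<noteq> \<one>"
  shows "\<one> \<preceq> down x \<and> down x \<noteq> \<one>"
  using assms le_trans[OF _ le_down, of \<one> x]
  by (simp add: down_def star_eq_one_iff circ_eq_one_iff)

text \<open>\<open>down x \<noteq> x\<close> says that star and \<open>circ\<close> differ at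
  \<open>rl_star A x\<close>. There \<open>circ_circ\<close> applies, so both steps can be
  undone.\<close>

lemma up_down: "\<lbrakk>x \<in> carrier A; down x \<noteq> x\<rbrakk> \<Longrightarrow> up (down x) = x"
  using circ_circ[of "rl_star A x"] by (simp add: up_def down_def star_star)

lemma down_up: "\<lbrakk>x \<in> carrier A; up x \<noteq> x\<rbrakk> \<Longrightarrow> down (up x) = x"
  using circ_circ[of x] star_star unfolding up_def down_def by (metis circ_closed)

lemma circ_eq_star_up: "x \<in> carrier A \<Longrightarrow> circ A x = rl_star A (up x)"
  by (simp add: up_def star_star)

lemma zig_0 [simp]: "zig a 0 = a"
  by (simp add: zig_def)

text \<open>By construction this holds only away from zero. The rule across negative indices needs
  \<open>up\<close> and \<open>down\<close> to be inverse and is confined to \<open>zig_dom\<close>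
  (\<open>up_zig\<close>).\<close>

lemma zig_succ: "0 \<le> i \<Longrightarrow> zig a (i + 1) = up (zig a i)"
  by (simp add: zig_def nat_add_distrib)

lemma zig_pred:
  assumes "i \<le> 0"
  shows "zig a (i - 1) = down (zig a i)"
proof -
  have "nat (- (i - 1)) = Suc (nat (- i))"
    using assms by simp
  moreover have "zig a i = (down ^^ nat (- i)) a"
    using assms by (auto simp: zig_def)
  ultimately show ?thesis
    using assms by (simp add: zig_def)
qed

lemma zig_induct:
  assumes "P a" "\<And>x. P x \<Longrightarrow> P (up x)" "\<And>x. P x \<Longrightarrow> P (down x)"
  shows "P (zig a i)"
proof -
  have "P ((up ^^ n) a)" "P ((down ^^ n) a)" for n
    by (induction n) (use assms in auto)
  then show ?thesis
    by (simp add: zig_def)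
qed

lemma zig_pos:
  assumes "a \<in> carrier A" "\<one> \<preceq> a" "a \<noteq> \<one>"
  shows "zig a i \<in> carrier A \<and> \<one> \<preceq> zig a i \<and> zig a i \<noteq> \<one>"
  by (rule zig_induct) (use assms up_pos down_pos in auto)

lemma zig_in_gen:
  assumes "a \<in> carrier A"
  shows "zig a i \<in> gen a"
  by (rule zig_induct)
    (use assms star_in_gen circ_in_gen gen_self in \<open>auto simp: up_def down_def\<close>)

lemma zig_antimono:
  assumes a: "a \<in> carrier A" "\<one> \<preceq> a" "a \<noteq> \<one>" and "i \<le> j"
  shows "zig a j \<preceq> zig a i"
  using assms(4)
proof (induction rule: int_ge_induct)
  case base
  show ?case
    using zig_pos[OF a] le_refl by blast
next
  case (step k)
  have c: "zig a l \<in> carrier A" for l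
    using zig_pos[OF a] by blast
  have "zig a (k + 1) \<preceq> zig a k"
  proof (cases "0 \<le> k")
    case True
    then show ?thesis
      using up_le c by (simp add: zig_succ)
  next
    case False
    then show ?thesis
      using le_down[OF c] zig_pred[of "k + 1" a] by simp
  qed
  then show ?case
    using step.IH c le_trans by blast
qed

text \<open>The maps \<open>up\<close> and \<open>down\<close> become stationary at the ends of a component, and are inverse to each
  other elsewhere. The set below consists of the indices reached before that happens.\<close>

definition zig_dom :: "'a \<Rightarrow> int set" where
  "zig_dom a = {i. (0 < i \<longrightarrow> zig a (i - 1) \<noteq> zig a i) \<and> (i < 0 \<longrightarrow> zig a i \<noteq> zig a (i + 1))}"

lemma zero_in_zig_dom: "0 \<in> zig_dom a"
  by (simp add: zig_dom_def)

text \<open>A repetition propagates outwards, because each value determines the next; so no index is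
  reached beyond a missing one.\<close>

lemma zig_dom_toward_zero:
  "\<lbrakk>i \<in> zig_dom a; 0 < i\<rbrakk> \<Longrightarrow> i - 1 \<in> zig_dom a"
  "\<lbrakk>i \<in> zig_dom a; i < 0\<rbrakk> \<Longrightarrow> i + 1 \<in> zig_dom a"
proof -
  assume i: "i \<in> zig_dom a" "0 < i"
  show "i - 1 \<in> zig_dom a"
  proof (cases "i = 1")
    case True
    then show ?thesis
      by (simp add: zero_in_zig_dom)
  next
    case False
    then have "zig a (i - 1) = up (zig a (i - 2))" "zig a i = up (zig a (i - 1))"
      using i zig_succ[of "i - 2" a] zig_succ[of "i - 1" a] by simp_all
    then show ?thesis
      using i False by (auto simp: zig_dom_def)
  qed
next
  assume i: "i \<in> zig_dom a" "i < 0"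
  show "i + 1 \<in> zig_dom a"
  proof (cases "i = - 1")
    case True
    then show ?thesis
      by (simp add: zero_in_zig_dom)
  next
    case False
    then have "zig a (i + 1) = down (zig a (i + 2))" "zig a i = down (zig a (i + 1))"
      using i zig_pred[of "i + 2" a] zig_pred[of "i + 1" a] by (simp_all add: add.commute)
    then show ?thesis
      using i False by (auto simp: zig_dom_def add.commute)
  qed
qed

lemma zig_dom_upto: "\<lbrakk>l \<in> zig_dom a; 0 \<le> k; k \<le> l\<rbrakk> \<Longrightarrow> k \<in> zig_dom a"
proof -
  assume l: "l \<in> zig_dom a" and k: "0 \<le> k" "k \<le> l"
  from k(2) k(1) show ?thesis
    by (induction rule: int_le_induct) (use l zig_dom_toward_zero(1) in auto)
qed

lemma zig_dom_downto: "\<lbrakk>i \<in> zig_dom a; k \<le> 0; i \<le> k\<rbrakk> \<Longrightarrow> k \<in> zig_dom a"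
proof -
  assume i: "i \<in> zig_dom a" and k: "k \<le> 0" "i \<le> k"
  from k(2) k(1) show ?thesis
    by (induction rule: int_ge_induct) (use i zig_dom_toward_zero(2) in auto)
qed

lemma zig_dom_convex: "\<lbrakk>i \<in> zig_dom a; l \<in> zig_dom a; i \<le> k; k \<le> l\<rbrakk> \<Longrightarrow> k \<in> zig_dom a"
  using zig_dom_upto zig_dom_downto by (cases "0 \<le> k") (metis, metis linorder_le_cases)

lemma zig_strict:
  assumes "i \<in> zig_dom a" "i + 1 \<in> zig_dom a"
  shows "zig a i \<noteq> zig a (i + 1)"
  using assms by (cases "0 \<le> i") (auto simp: zig_dom_def)

lemma up_zig:
  assumes a: "a \<in> carrier A" "\<one> \<preceq> a" "a \<noteq> \<one>" and i: "i \<in> zig_dom a"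
  shows "up (zig a i) = (if i + 1 \<in> zig_dom a then zig a (i + 1) else zig a i)"
proof (cases "0 \<le> i")
  case True
  then have "up (zig a i) = zig a (i + 1)"
    by (simp add: zig_succ)
  moreover have "zig a (i + 1) = zig a i" if "i + 1 \<notin> zig_dom a"
    using that True by (auto simp: zig_dom_def)
  ultimately show ?thesis
    by auto
next
  case False
  then have "i + 1 \<in> zig_dom a" "zig a i = down (zig a (i + 1))"
    using i zig_dom_toward_zero(2) zig_pred[of "i + 1" a] by auto
  \<comment> \<open>On this side \<open>zig\<close> was built by \<open>down\<close>;
    \<open>zig_strict\<close> excludes a fixed point, so \<open>up_down\<close> inverts the
    step.\<close>
  then show ?thesis
    using zig_strict[OF i] up_down[of "zig a (i + 1)"] zig_pos[OF a, of "i + 1"] by auto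
qed

lemma down_zig:
  assumes a: "a \<in> carrier A" "\<one> \<preceq> a" "a \<noteq> \<one>" and i: "i \<in> zig_dom a"
  shows "down (zig a i) = (if i - 1 \<in> zig_dom a then zig a (i - 1) else zig a i)"
proof (cases "i \<le> 0")
  case True
  then have "down (zig a i) = zig a (i - 1)"
    by (simp add: zig_pred)
  moreover have "zig a (i - 1) = zig a i" if "i - 1 \<notin> zig_dom a"
    using that True by (auto simp: zig_dom_def)
  ultimately show ?thesis
    by auto
next
  case False
  then have "i - 1 \<in> zig_dom a" "zig a i = up (zig a (i - 1))"
    using i zig_dom_toward_zero(1) zig_succ[of "i - 1" a] by auto
  then show ?thesis
    using zig_strict[of "i - 1" a] i down_up[of "zig a (i - 1)"] zig_pos[OF a, of "i - 1"] by auto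
qed

lemma zig_less:
  assumes a: "a \<in> carrier A" "\<one> \<preceq> a" "a \<noteq> \<one>"
    and ij: "i \<in> zig_dom a" "j \<in> zig_dom a" "i < j"
  shows "\<not> zig a i \<preceq> zig a j"
proof
  assume le: "zig a i \<preceq> zig a j"
  have c: "zig a l \<in> carrier A" for l
    using zig_pos[OF a] by blast
  have "zig a j \<preceq> zig a (i + 1)" "zig a (i + 1) \<preceq> zig a i"
    using zig_antimono[OF a] ij by simp_all
  then have "zig a i = zig a (i + 1)"
    using le c le_trans le_antisym by metis
  moreover have "i + 1 \<in> zig_dom a"
    using zig_dom_convex[OF ij(1,2)] ij(3) by simp
  ultimately show False
    using zig_strict ij by blast
qed

lemma zig_le_iff:
  assumes "a \<in> carrier A" "\<one> \<preceq> a" "a \<noteq> \<one>" "i \<in> zig_dom a" "j \<in> zig_dom a"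
  shows "zig a i \<preceq> zig a j \<longleftrightarrow> j \<le> i"
  using zig_less[OF assms] zig_antimono[OF assms(1-3), of j i] by force

text \<open>The right-hand side is closed under \<open>circ\<close>: \<open>circ\<close> of a
  positive element is the star of its \<open>up\<close>, and \<open>circ\<close> of its star is its
  \<open>down\<close>. At the ends of \<open>zig_dom\<close> these maps are stationary.\<close>

lemma gen_eq_zig:
  assumes a: "a \<in> carrier A" "\<one> \<preceq> a" "a \<noteq> \<one>"
  shows "gen a = insert \<one> (zig a ` zig_dom a \<union> (\<lambda>i. rl_star A (zig a i)) ` zig_dom a)"
    (is "_ = ?K")
proof
  note z = zig_pos[OF a]
  have s: "rl_star A (rl_star A (zig a i)) = zig a i" for i
    using z star_star by blast
  have "circ A (zig a i) \<in> ?K \<and> circ A (rl_star A (zig a i)) \<in> ?K" if "i \<in> zig_dom a" for i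
    using that up_zig[OF a that] down_zig[OF a that] z circ_eq_star_up[of "zig a i"]
    by (auto simp flip: down_def)
  then have "subuniverse A ?K"
    by (intro subuniverseI) (use z s in auto)
  moreover have "a \<in> ?K"
    using zero_in_zig_dom[of a] zig_0 by (metis UnCI image_eqI insertCI)
  ultimately show "gen a \<subseteq> ?K"
    by (intro hull_minimal) auto
  show "?K \<subseteq> gen a"
    using zig_in_gen one_in_gen star_in_gen a by auto
qed

lemma crownian_gen:
  assumes a: "a \<in> carrier A" "\<one> \<preceq> a" "a \<noteq> \<one>"
  shows "crownian (A\<lparr>carrier := gen a\<rparr>)"
proof -
  let ?J = "zig_dom a" and ?z = "zig a"
  \<comment> \<open>\<open>zig a i\<close> is paired with its \<open>circ\<close>, which is the star
    of \<open>zig a (i + 1)\<close>. The test singles out the left-zero pairs, those of type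
    \<open>two_L\<close>.\<close>
  define L where "L = {i. rl_star A (?z (i + 1)) \<otimes> ?z i = rl_star A (?z (i + 1))}"
  define g where "g = case_sum (\<lambda>(i, t). case t of pt_a \<Rightarrow> ?z i | pt_b \<Rightarrow> rl_star A (?z (i + 1)))
    (\<lambda>_::unit. \<one>)"
  let ?P = "zcrown ?J L"
  have z: "?z i \<in> carrier A" "\<one> \<preceq> ?z i" "?z i \<noteq> \<one>" for i
    using zig_pos[OF a] by blast+
  have s: "rl_star A (?z i) \<in> carrier A" "rl_star A (?z i) \<preceq> \<one>" "rl_star A (?z i) \<noteq> \<one>" for i
    using z star_nonpos by (auto simp: star_eq_one_iff)
  have z': "\<not> ?z i \<preceq> \<one>" "\<one> \<noteq> ?z i" and s': "\<not> \<one> \<preceq> rl_star A (?z i)" "\<one> \<noteq> rl_star A (?z i)" for i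
    using z[of i] s[of i] le_antisym by (metis one_closed)+
  have zs: "?z i \<noteq> rl_star A (?z j)" "rl_star A (?z j) \<noteq> ?z i" for i j
    using z[of i] s[of j] z'(1)[of i] by metis+
  have le: "?z i \<preceq> ?z j \<longleftrightarrow> j \<le> i" if "i \<in> ?J" "j \<in> ?J" for i j
    using zig_le_iff[OF a that] .
  have eq: "?z i = ?z j \<longleftrightarrow> i = j" if "i \<in> ?J" "j \<in> ?J" for i j
    using le[OF that] le[OF that(2,1)] z(1) le_refl by (metis eq_iff)
  have g_in: "g p \<in> gen a" if "p \<in> pts ?P" for p
    using that unfolding gen_eq_zig[OF a] g_def by (auto split: two.splits)
  have inj: "inj_on g (pts ?P)"
    by (rule inj_onI)
      (auto simp: g_def eq zs z z' s s' dest!: star_inj split: two.splits)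
  have surj: "gen a \<subseteq> g ` pts ?P"
  proof
    fix x
    assume "x \<in> gen a"
    then consider "x = \<one>" | i where "i \<in> ?J" "x = ?z i" | i where "i \<in> ?J" "x = rl_star A (?z i)"
      unfolding gen_eq_zig[OF a] by blast
    then show "x \<in> g ` pts ?P"
    proof cases
      case 1
      then show ?thesis
        by (intro image_eqI[of _ _ "Inr ()"]) (simp_all add: g_def)
    next
      case (2 i)
      then show ?thesis
        by (intro image_eqI[of _ _ "Inl (i, pt_a)"]) (simp_all add: g_def)
    next
      case (3 i)
      then show ?thesis
        by (intro image_eqI[of _ _ "Inl (i - 1, pt_b)"]) (simp_all add: g_def)
    qed
  qed
  have aa: "?z i \<otimes> ?z j = ?z i \<longleftrightarrow> i \<le> j" if "i \<in> ?J" "j \<in> ?J" for i j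
    using pos_mult[of "?z i" "?z j"] z le eq that by auto
  have bb: "rl_star A (?z i) \<otimes> rl_star A (?z j) = rl_star A (?z i) \<longleftrightarrow> i \<le> j"
    if "i \<in> ?J" "j \<in> ?J" for i j
    using neg_mult[of "rl_star A (?z i)" "rl_star A (?z j)"] s z le eq star_le_star_iff that
      star_inj[of "?z i" "?z j"] by auto
  have ba: "rl_star A (?z (j + 1)) \<otimes> ?z i = rl_star A (?z (j + 1)) \<longleftrightarrow> j < i \<or> (j = i \<and> i \<in> L)"
    and ab: "?z i \<otimes> rl_star A (?z (j + 1)) = ?z i \<longleftrightarrow> i < j \<or> (j = i \<and> i \<in> L)"
    if ij: "i \<in> ?J" "j + 1 \<in> ?J" for i j
  proof -
    let ?b = "rl_star A (?z (j + 1))"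
    have ba1: "?b \<otimes> ?z i = ?b \<longleftrightarrow> ?b \<otimes> ?z i \<preceq> \<one>"
      using mult_eq_neg_pos[of ?b "?z i"] z s z' zs by (metis (full_types))
    have ab1: "?z i \<otimes> ?b = ?z i \<longleftrightarrow> \<not> ?z i \<otimes> ?b \<preceq> \<one>"
      using mult_eq_pos_neg[of "?z i" ?b] z s z' zs by (metis (full_types))
    \<comment> \<open>Compare \<open>?b\<close> with the star and \<open>circ\<close> of
      \<open>?z i\<close>: below the star both products are negative, strictly above
      \<open>circ\<close> neither is, and at \<open>circ\<close> exactly one is. In the last case
      \<open>L\<close> tells which.\<close>
    consider "j < i" | "i < j" | "i = j"
      by linarith
    then have "(?b \<otimes> ?z i \<preceq> \<one> \<longleftrightarrow> j < i \<or> (j = i \<and> i \<in> L)) \<and>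
        (\<not> ?z i \<otimes> ?b \<preceq> \<one> \<longleftrightarrow> i < j \<or> (j = i \<and> i \<in> L))"
    proof cases
      case 1
      then have "?b \<preceq> rl_star A (?z i)"
        using le[OF ij] star_le_star_iff z by simp
      then show ?thesis
        using 1 le_star_iff[of "?z i" ?b] z s by auto
    next
      case 2
      then have i1: "i + 1 \<in> ?J"
        using zig_dom_convex[OF ij] by simp
      then have "circ A (?z i) = rl_star A (?z (i + 1))"
        using up_zig[OF a ij(1)] circ_eq_star_up z by simp
      then have "\<not> ?b \<preceq> circ A (?z i)"
        using le[OF i1 ij(2)] star_le_star_iff z 2 by simp
      then show ?thesis
        using 2 le_circ_iff[of "?z i" ?b] z s by auto
    next
      case 3
      then have c: "circ A (?z i) = ?b"
        using up_zig[OF a ij(1)] circ_eq_star_up z ij by simp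
      moreover have "?b \<noteq> rl_star A (?z i)"
        using eq[of i "j + 1"] 3 ij star_inj[of "?z (j + 1)" "?z i"] z(1) by auto
      ultimately have "?z i \<otimes> ?b \<noteq> ?b \<otimes> ?z i"
        using noncomm_circ[of "?z i"] z by simp
      then have "?z i \<otimes> ?b = ?z i \<longleftrightarrow> ?b \<otimes> ?z i = ?b"
        using mult_cases[of "?z i" ?b] mult_cases[of ?b "?z i"] z s by metis
      then show ?thesis
        using 3 ba1 ab1 by (auto simp: L_def)
    qed
    then show "?b \<otimes> ?z i = ?b \<longleftrightarrow> j < i \<or> (j = i \<and> i \<in> L)"
      "?z i \<otimes> ?b = ?z i \<longleftrightarrow> i < j \<or> (j = i \<and> i \<in> L)"
      using ba1 ab1 by blast+
  qed
  have sq: "sqle ?P p q \<longleftrightarrow> g p \<otimes> g q = g p" if "p \<in> pts ?P" "q \<in> pts ?P" for p q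
    using that by (auto simp: g_def aa bb ab ba z z' s s' split: two.splits)
  have "epreorder_iso ?P (rl_epreorder (A\<lparr>carrier := gen a\<rparr>)) g"
    unfolding epreorder_iso_def
  proof (intro conjI ballI)
    show "bij_betw g (pts ?P) (pts (rl_epreorder (A\<lparr>carrier := gen a\<rparr>)))"
      using inj surj g_in by (auto simp: bij_betw_def rl_epreorder_def)
  next
    fix p q
    assume "p \<in> pts ?P" "q \<in> pts ?P"
    then show "sqle ?P p q \<longleftrightarrow> sqle (rl_epreorder (A\<lparr>carrier := gen a\<rparr>)) (g p) (g q)"
      by (simp add: sq rl_epreorder_def)
  next
    fix p
    assume p: "p \<in> pts ?P"
    have "rl_le (A\<lparr>carrier := gen a\<rparr>) = rl_le A"
      by (simp add: rl_le_def fun_eq_iff)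
    moreover have "p \<in> pos ?P \<longleftrightarrow> \<one> \<preceq> g p" "p \<in> neg ?P \<longleftrightarrow> g p \<preceq> \<one>"
      using p z z' s s' by (auto simp: g_def le_refl split: two.splits)
    ultimately show "p \<in> pos ?P \<longleftrightarrow> g p \<in> pos (rl_epreorder (A\<lparr>carrier := gen a\<rparr>))"
      "p \<in> neg ?P \<longleftrightarrow> g p \<in> neg (rl_epreorder (A\<lparr>carrier := gen a\<rparr>))"
      using g_in[OF p] by (simp_all add: rl_epreorder_def)
  qed
  moreover have "inv_into (pts ?P) g \<one> = Inr ()"
    using inv_into_f_f[OF inj, of "Inr ()"] by (simp add: g_def)
  ultimately have "has_crown (A\<lparr>carrier := gen a\<rparr>) ?P"
    unfolding has_crown_def using epreorder_iso_sym by fastforce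
  then show ?thesis
    by (rule crownianI[OF subuniverse_irc[OF subuniverse_gen[OF a(1)]] _ zero_in_zig_dom])
      (rule zig_dom_convex)
qed

end

section \<open>Nested sums\<close>

text \<open>Meet and join are determined by the order, the residuals by order and product.\<close>

lemma rl_isoI:
  assumes A: "idempotent_residuated_chain A" and B: "idempotent_residuated_chain B"
    and bij: "bij_betw h (carrier A) (carrier B)"
    and mult: "\<And>x y. \<lbrakk>x \<in> carrier A; y \<in> carrier A\<rbrakk> \<Longrightarrow> h (x \<otimes>\<^bsub>A\<^esub> y) = h x \<otimes>\<^bsub>B\<^esub> h y"
    and le: "\<And>x y. \<lbrakk>x \<in> carrier A; y \<in> carrier A\<rbrakk> \<Longrightarrow> rl_le A x y \<longleftrightarrow> rl_le B (h x) (h y)"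
  shows "rl_iso A B h"
proof -
  interpret A: idempotent_residuated_chain A by fact
  interpret B: idempotent_residuated_chain B by fact
  have h: "h x \<in> carrier B" if "x \<in> carrier A" for x
    using bij that by (auto dest: bij_betwE)
  have surj: "\<exists>x \<in> carrier A. w = h x" if "w \<in> carrier B" for w
    using bij that by (auto simp: bij_betw_def)
  have one: "h \<one>\<^bsub>A\<^esub> = \<one>\<^bsub>B\<^esub>"
  proof -
    obtain e where e: "e \<in> carrier A" "\<one>\<^bsub>B\<^esub> = h e"
      using surj B.one_closed by blast
    then have "h e = h e \<otimes>\<^bsub>B\<^esub> h \<one>\<^bsub>A\<^esub>"
      using mult[of e "\<one>\<^bsub>A\<^esub>"] by simp
    then show ?thesis
      using e(2) h by (metis A.one_closed B.l_one)
  qed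
  have lres: "h (lres A x y) = lres B (h x) (h y)" if xy: "x \<in> carrier A" "y \<in> carrier A" for x y
  proof (rule B.lres_unique)
    fix w assume "w \<in> carrier B"
    then obtain u where u: "u \<in> carrier A" "w = h u"
      using surj by blast
    then show "rl_le B w (h (lres A x y)) \<longleftrightarrow> rl_le B (h x \<otimes>\<^bsub>B\<^esub> w) (h y)"
      using le[of u "lres A x y"] le[of "x \<otimes>\<^bsub>A\<^esub> u" y] xy A.lres_residual
      by (simp add: A.lres_closed mult)
  qed (use xy h A.lres_closed in auto)
  have rres: "h (rres A x y) = rres B (h x) (h y)" if xy: "x \<in> carrier A" "y \<in> carrier A" for x y
  proof (rule B.rres_unique)
    fix w assume "w \<in> carrier B"
    then obtain u where u: "u \<in> carrier A" "w = h u"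
      using surj by blast
    then show "rl_le B w (h (rres A x y)) \<longleftrightarrow> rl_le B (w \<otimes>\<^bsub>B\<^esub> h y) (h x)"
      using le[of u "rres A x y"] le[of "u \<otimes>\<^bsub>A\<^esub> y" x] xy A.rres_residual[of u y x]
      by (simp add: A.rres_closed mult)
  qed (use xy h A.rres_closed in auto)
  show ?thesis
    using bij one mult lres rres le h
    by (simp add: rl_iso_def A.wedge_eq B.wedge_eq A.vee_eq B.vee_eq)
qed

text \<open>Beyond the isomorphism nothing is known about \<open>A\<close>, so closure and every law
  are transported from \<open>N\<close>.\<close>

lemma star_involutive_iso:
  assumes N: "star_involutive_irc N" and iso: "rl_iso N A h"
  shows "star_involutive_irc A"
proof -
  interpret N: star_involutive_irc N by fact
  have A: "carrier A = h ` carrier N" and inj: "inj_on h (carrier N)" and one: "\<one>\<^bsub>A\<^esub> = h \<one>\<^bsub>N\<^esub>"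
    using iso by (auto simp: rl_iso_def bij_betw_def)
  have hom: "h x \<otimes>\<^bsub>A\<^esub> h y = h (x \<otimes>\<^bsub>N\<^esub> y)" "wedge A (h x) (h y) = h (wedge N x y)"
    "vee A (h x) (h y) = h (vee N x y)" "lres A (h x) (h y) = h (lres N x y)"
    "rres A (h x) (h y) = h (rres N x y)" if "x \<in> carrier N" "y \<in> carrier N" for x y
    using iso that by (simp_all add: rl_iso_def)
  note closed = N.wedge_closed N.vee_closed N.lres_closed N.rres_closed
  have eq: "h x = h y \<longleftrightarrow> x = y" if "x \<in> carrier N" "y \<in> carrier N" for x y
    using inj that by (simp add: inj_on_eq_iff)
  have le: "rl_le A (h x) (h y) \<longleftrightarrow> rl_le N x y" if "x \<in> carrier N" "y \<in> carrier N" for x y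
    using that by (simp add: rl_le_def hom closed eq)
  have star: "rl_star A (h x) = h (rl_star N x)" if "x \<in> carrier N" for x
    using that by (simp add: rl_star_def lneg_def rneg_def one hom closed)
  have lat: "wedge A x y = wedge A y x" "vee A x y = vee A y x"
    if "x \<in> carrier A" "y \<in> carrier A" for x y
    using that N.wedge_comm N.vee_comm unfolding A by (auto simp: hom)
  have tot: "rl_le A x y \<or> rl_le A y x" if xy: "x \<in> carrier A" "y \<in> carrier A" for x y
  proof -
    obtain u v where "u \<in> carrier N" "v \<in> carrier N" "x = h u" "y = h v"
      using xy A by auto
    then show ?thesis
      using N.le_total[of u v] by (simp add: le)
  qed
  show ?thesis
    by unfold_locales
      (fact lat tot | (auto simp: A one hom closed le star N.star_star N.idem N.m_assoc
        N.wedge_assoc N.vee_assoc N.wedge_absorb N.vee_absorb N.lres_residual N.rres_residual)[1])+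
qed

text \<open>In a nested sum meet and join are defined from the order, so the lattice laws have to be
  derived from linearity.\<close>

lemma irc_of_linear_order:
  fixes A :: "('a, 'm) rl_scheme" (structure) and leq :: "'a \<Rightarrow> 'a \<Rightarrow> bool"
  assumes mon: "monoid A" and idem: "\<And>x. x \<in> carrier A \<Longrightarrow> x \<otimes> x = x"
    and lres_closed: "\<And>x y. \<lbrakk>x \<in> carrier A; y \<in> carrier A\<rbrakk> \<Longrightarrow> lres A x y \<in> carrier A"
    and rres_closed: "\<And>x y. \<lbrakk>x \<in> carrier A; y \<in> carrier A\<rbrakk> \<Longrightarrow> rres A x y \<in> carrier A"
    and wedge: "\<And>x y. wedge A x y = (if leq x y then x else y)"
    and vee: "\<And>x y. vee A x y = (if leq x y then y else x)"
    and total: "\<And>x y. \<lbrakk>x \<in> carrier A; y \<in> carrier A\<rbrakk> \<Longrightarrow> leq x y \<or> leq y x"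
    and antisym: "\<And>x y. \<lbrakk>leq x y; leq y x; x \<in> carrier A; y \<in> carrier A\<rbrakk> \<Longrightarrow> x = y"
    and trans: "\<And>x y z. \<lbrakk>leq x y; leq y z; x \<in> carrier A; y \<in> carrier A; z \<in> carrier A\<rbrakk> \<Longrightarrow> leq x z"
    and lres: "\<And>x y z. \<lbrakk>x \<in> carrier A; y \<in> carrier A; z \<in> carrier A\<rbrakk>
      \<Longrightarrow> leq y (lres A x z) \<longleftrightarrow> leq (x \<otimes> y) z"
    and rres: "\<And>x y z. \<lbrakk>x \<in> carrier A; y \<in> carrier A; z \<in> carrier A\<rbrakk>
      \<Longrightarrow> leq (x \<otimes> y) z \<longleftrightarrow> leq x (rres A z y)"
  shows "idempotent_residuated_chain A" "\<And>x y. x \<in> carrier A \<Longrightarrow> rl_le A x y \<longleftrightarrow> leq x y"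
proof -
  interpret monoid A by fact
  show rl_le: "rl_le A x y \<longleftrightarrow> leq x y" if "x \<in> carrier A" for x y
    using total[OF that that] by (auto simp: rl_le_def wedge)
  have comm: "wedge A x y = wedge A y x" "vee A x y = vee A y x"
    if "x \<in> carrier A" "y \<in> carrier A" for x y
    using total antisym that by (auto simp: wedge vee)
  have assoc: "wedge A (wedge A x y) z = wedge A x (wedge A y z)"
      "vee A (vee A x y) z = vee A x (vee A y z)"
    if c: "x \<in> carrier A" "y \<in> carrier A" "z \<in> carrier A" for x y z
    using c trans[of x y z] trans[of z y x] total[of x y] total[of y z] total[of x z]
      antisym[of x z] trans[of x z y] trans[of y x z]
    by (auto simp: wedge vee)
  have absorb: "wedge A x (vee A x y) = x" "vee A x (wedge A x y) = x"
    if "x \<in> carrier A" "y \<in> carrier A" for x y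
    using that total[of x x] total[of x y] antisym[of x y] by (auto simp: wedge vee)
  show "idempotent_residuated_chain A"
    by unfold_locales
      (use comm total in \<open>auto simp: rl_le assoc absorb lres_closed rres_closed lres rres idem\<close>,
        simp_all add: wedge vee)
qed

text \<open>A term over a nested sum is evaluated in the summand of the smallest index \<open>m\<close> occurring in
  it. The projection \<open>proj m\<close> to that summand sends all other summands to the identity; it respects
  the operations on elements of index at least \<open>m\<close>.\<close>

definition proj :: "('i \<Rightarrow> ('a, 'm) rl_scheme) \<Rightarrow> 'i \<Rightarrow> ('i \<times> 'a) option \<Rightarrow> 'a" where
  "proj B m x = (case x of None \<Rightarrow> \<one>\<^bsub>B m\<^esub> | Some (i, a) \<Rightarrow> if i = m then a else \<one>\<^bsub>B m\<^esub>)"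

definition index_ge :: "('i \<times> 'i) set \<Rightarrow> 'i \<Rightarrow> ('i \<times> 'a) option \<Rightarrow> bool" where
  "index_ge r m x \<longleftrightarrow> (case x of None \<Rightarrow> True | Some (i, a) \<Rightarrow> (m, i) \<in> r)"

definition has_index :: "'i \<Rightarrow> ('i \<times> 'a) option \<Rightarrow> bool" where
  "has_index m x \<longleftrightarrow> (case x of None \<Rightarrow> False | Some (i, a) \<Rightarrow> i = m)"

lemma proj_simps [simp]:
  "proj B m None = \<one>\<^bsub>B m\<^esub>" "proj B m (Some (i, a)) = (if i = m then a else \<one>\<^bsub>B m\<^esub>)"
  by (simp_all add: proj_def)

lemma index_simps [simp]:
  "index_ge r m None" "index_ge r m (Some (i, a)) \<longleftrightarrow> (m, i) \<in> r"
  "\<not> has_index m None" "has_index m (Some (i, a)) \<longleftrightarrow> i = m"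
  by (simp_all add: index_ge_def has_index_def)

lemma proj_nest_emb [simp]: "proj B m (nest_emb B i a) = (if i = m then a else \<one>\<^bsub>B m\<^esub>)"
  by (simp add: nest_emb_def)

lemma index_ge_nest_emb: "(m, i) \<in> r \<Longrightarrow> index_ge r m (nest_emb B i a)"
  by (simp add: nest_emb_def)

locale nested =
  fixes I :: "'i set" and r :: "('i \<times> 'i) set" and B :: "'i \<Rightarrow> ('a, 'm) rl_scheme"
  assumes nestable: "nestable I r B"
begin

abbreviation N where "N \<equiv> nested_sum I r B"

lemma r_refl: "i \<in> I \<Longrightarrow> (i, i) \<in> r"
  using nestable by (auto simp: nestable_def linear_order_on_def
      partial_order_on_def preorder_on_def refl_on_def)

lemma r_trans: "\<lbrakk>(i, j) \<in> r; (j, k) \<in> r\<rbrakk> \<Longrightarrow> (i, k) \<in> r"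
  using nestable by (auto simp: nestable_def linear_order_on_def
      partial_order_on_def preorder_on_def dest: transD)

lemma r_antisym: "\<lbrakk>(i, j) \<in> r; (j, i) \<in> r\<rbrakk> \<Longrightarrow> i = j"
  using nestable by (auto simp: nestable_def linear_order_on_def partial_order_on_def dest: antisymD)

lemma r_total: "\<lbrakk>i \<in> I; j \<in> I\<rbrakk> \<Longrightarrow> (i, j) \<in> r \<or> (j, i) \<in> r"
  using nestable r_refl unfolding nestable_def linear_order_on_def total_on_def by metis

lemma irc: "i \<in> I \<Longrightarrow> idempotent_residuated_chain (B i)"
  using nestable by (simp add: nestable_def)

lemma mon: "i \<in> I \<Longrightarrow> monoid (B i)"
  using irc by (simp add: idempotent_residuated_chain_def residuated_lattice_def)

lemma one_closed: "i \<in> I \<Longrightarrow> \<one>\<^bsub>B i\<^esub> \<in> carrier (B i)"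
  using mon by (simp add: monoid.one_closed)

lemma rl_le_refl: "\<lbrakk>i \<in> I; a \<in> carrier (B i)\<rbrakk> \<Longrightarrow> rl_le (B i) a a"
  using irc residuated_lattice.le_refl by (metis idempotent_residuated_chain_def)

lemma rl_le_antisym:
  "\<lbrakk>rl_le (B i) a b; rl_le (B i) b a; i \<in> I; a \<in> carrier (B i); b \<in> carrier (B i)\<rbrakk> \<Longrightarrow> a = b"
  using irc residuated_lattice.le_antisym by (metis idempotent_residuated_chain_def)

lemma carrier_cases [consumes 1, case_names None Some]:
  assumes "x \<in> carrier N"
  obtains "x = None"
  | i a where "x = Some (i, a)" "i \<in> I" "a \<in> carrier (B i)" "a \<noteq> \<one>\<^bsub>B i\<^esub>"
  using assms by (auto simp: nested_sum_def)

lemma None_in_carrier [simp]: "None \<in> carrier N"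
  by (simp add: nested_sum_def)

lemma nest_emb_in_carrier: "\<lbrakk>i \<in> I; a \<in> carrier (B i)\<rbrakk> \<Longrightarrow> nest_emb B i a \<in> carrier N"
  by (simp add: nested_sum_def nest_emb_def)

lemma proj_closed: "\<lbrakk>m \<in> I; x \<in> carrier N\<rbrakk> \<Longrightarrow> proj B m x \<in> carrier (B m)"
  by (auto elim!: carrier_cases simp: one_closed)

lemma proj_eq_one_iff: "x \<in> carrier N \<Longrightarrow> proj B m x = \<one>\<^bsub>B m\<^esub> \<longleftrightarrow> \<not> has_index m x"
  by (auto elim!: carrier_cases)

lemma proj_inject: "\<lbrakk>proj B m x = proj B m y; has_index m x; has_index m y\<rbrakk> \<Longrightarrow> x = y"
  by (auto simp: has_index_def split: option.splits prod.splits)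

text \<open>Only three elements are inspected at a time, so a smallest occurring index exists
  although the chain may have no least element. The first case is the one without any index.\<close>

lemma obtain_min:
  assumes "x \<in> carrier N" "y \<in> carrier N" "z \<in> carrier N"
  obtains "x = None" "y = None" "z = None"
  | m where "m \<in> I" "index_ge r m x" "index_ge r m y" "index_ge r m z"
      "has_index m x \<or> has_index m y \<or> has_index m z"
proof -
  have "(x = None \<and> y = None \<and> z = None) \<or> (\<exists>m \<in> I. index_ge r m x \<and> index_ge r m y \<and>
      index_ge r m z \<and> (has_index m x \<or> has_index m y \<or> has_index m z))"
    using assms
    by (elim carrier_cases; simp; metis r_total r_refl r_trans)
  then show ?thesis
    using that by blast
qed

text \<open>The condition on identities covers arguments of index above \<open>m\<close>: both they
  and their result project to the identity.\<close>

lemma proj_op: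
  assumes "index_ge r m x" "index_ge r m y" "x \<in> carrier N" "y \<in> carrier N"
    and "f (B m) \<one>\<^bsub>B m\<^esub> \<one>\<^bsub>B m\<^esub> = \<one>\<^bsub>B m\<^esub>"
  shows "proj B m (nest_op r B f x y) = f (B m) (proj B m x) (proj B m y)"
  using assms(3,4,1,2,5)
  by (elim carrier_cases) (auto simp: nest_op_def dest: r_antisym)

lemma index_ge_op:
  "\<lbrakk>index_ge r m x; index_ge r m y; x \<in> carrier N; y \<in> carrier N\<rbrakk>
    \<Longrightarrow> index_ge r m (nest_op r B f x y)"
  by (elim carrier_cases) (auto simp: nest_op_def intro!: index_ge_nest_emb)

lemma op_closed:
  assumes "x \<in> carrier N" "y \<in> carrier N"
    and "\<And>i a b. \<lbrakk>i \<in> I; a \<in> carrier (B i); b \<in> carrier (B i)\<rbrakk> \<Longrightarrow> f (B i) a b \<in> carrier (B i)"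
  shows "nest_op r B f x y \<in> carrier N"
  using assms(1,2)
  by (elim carrier_cases) (auto simp: nest_op_def intro!: nest_emb_in_carrier assms(3) one_closed)

text \<open>If only indices above \<open>m\<close> occurred, both projections would be the identity
  and the comparison would be lost.\<close>

lemma nest_le_iff:
  assumes "index_ge r m x" "index_ge r m y" "x \<in> carrier N" "y \<in> carrier N" "m \<in> I"
    and "has_index m x \<or> has_index m y \<or> x = None \<and> y = None"
  shows "nest_le r B x y \<longleftrightarrow> rl_le (B m) (proj B m x) (proj B m y)"
  using assms(3,4,1,2,5,6)
  by (elim carrier_cases) (auto simp: nest_le_def rl_le_refl one_closed dest: r_antisym)

lemma nest_le_proj:
  assumes "index_ge r m x" "index_ge r m y" "x \<in> carrier N" "y \<in> carrier N" "m \<in> I"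
    and "nest_le r B x y"
  shows "rl_le (B m) (proj B m x) (proj B m y)"
proof (cases "has_index m x \<or> has_index m y")
  case True
  then show ?thesis
    using nest_le_iff assms by blast
next
  case False
  then have "proj B m x = \<one>\<^bsub>B m\<^esub>" "proj B m y = \<one>\<^bsub>B m\<^esub>"
    using assms proj_eq_one_iff by blast+
  then show ?thesis
    using assms(5) by (simp add: rl_le_refl one_closed)
qed

lemma nest_le_total:
  assumes x: "x \<in> carrier N" and y: "y \<in> carrier N"
  shows "nest_le r B x y \<or> nest_le r B y x"
  using x y y
proof (cases rule: obtain_min)
  case 1
  then show ?thesis
    by (simp add: nest_le_def)
next
  case (2 m)
  then have "rl_le (B m) (proj B m x) (proj B m y) \<or> rl_le (B m) (proj B m y) (proj B m x)"
    using idempotent_residuated_chain.le_total irc proj_closed x y by metis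
  then show ?thesis
    using nest_le_iff[of m x y] nest_le_iff[of m y x] 2 x y by blast
qed

lemma nest_le_antisym:
  assumes "nest_le r B x y" "nest_le r B y x" and x: "x \<in> carrier N" and y: "y \<in> carrier N"
  shows "x = y"
  using x y y
proof (cases rule: obtain_min)
  case (2 m)
  then have "proj B m x = proj B m y"
    using nest_le_proj[of m x y] nest_le_proj[of m y x] rl_le_antisym assms proj_closed by metis
  then show ?thesis
    using 2 proj_inject proj_eq_one_iff x y by metis
qed simp

lemma nest_le_trans:
  assumes le: "nest_le r B x y" "nest_le r B y z"
    and c: "x \<in> carrier N" "y \<in> carrier N" "z \<in> carrier N"
  shows "nest_le r B x z"
  using c
proof (cases rule: obtain_min)
  case 1
  then show ?thesis
    by (simp add: nest_le_def)
next
  case (2 m)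
  then interpret Bm: idempotent_residuated_chain "B m"
    using irc by blast
  have le': "rl_le (B m) (proj B m x) (proj B m y)" "rl_le (B m) (proj B m y) (proj B m z)"
    using nest_le_proj 2 le c by blast+
  then have "rl_le (B m) (proj B m x) (proj B m z)"
    using Bm.le_trans proj_closed 2 c by blast
  \<comment> \<open>If only \<open>y\<close> had index \<open>m\<close>, its projection would lie
    between 1 and 1.\<close>
  moreover have "has_index m x \<or> has_index m z"
  proof (rule ccontr)
    assume n: "\<not> ?thesis"
    then have "proj B m x = \<one>\<^bsub>B m\<^esub>" "proj B m z = \<one>\<^bsub>B m\<^esub>"
      using c proj_eq_one_iff by blast+
    then have "proj B m y = \<one>\<^bsub>B m\<^esub>"
      using le' Bm.le_antisym[of "proj B m y" "\<one>\<^bsub>B m\<^esub>"] proj_closed 2 c by simp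
    then show False
      using n 2 c proj_eq_one_iff by blast
  qed
  ultimately show ?thesis
    using nest_le_iff 2 c by blast
qed

lemma one_one:
  assumes "i \<in> I"
  shows "\<one>\<^bsub>B i\<^esub> \<otimes>\<^bsub>B i\<^esub> \<one>\<^bsub>B i\<^esub> = \<one>\<^bsub>B i\<^esub>" "lres (B i) \<one>\<^bsub>B i\<^esub> \<one>\<^bsub>B i\<^esub> = \<one>\<^bsub>B i\<^esub>"
    "rres (B i) \<one>\<^bsub>B i\<^esub> \<one>\<^bsub>B i\<^esub> = \<one>\<^bsub>B i\<^esub>"
proof -
  interpret Bi: idempotent_residuated_chain "B i"
    using irc assms by blast
  show "\<one>\<^bsub>B i\<^esub> \<otimes>\<^bsub>B i\<^esub> \<one>\<^bsub>B i\<^esub> = \<one>\<^bsub>B i\<^esub>" "lres (B i) \<one>\<^bsub>B i\<^esub> \<one>\<^bsub>B i\<^esub> = \<one>\<^bsub>B i\<^esub>"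
    "rres (B i) \<one>\<^bsub>B i\<^esub> \<one>\<^bsub>B i\<^esub> = \<one>\<^bsub>B i\<^esub>"
    using Bi.rneg_one Bi.lneg_one by (simp_all add: rneg_def lneg_def)
qed

text \<open>This is what the side condition on the summands is for.\<close>

lemma residual_eq_one:
  assumes m: "m \<in> I" "\<not> (\<forall>j\<in>I. (j, m) \<in> r)" and ab: "a \<in> carrier (B m)" "b \<in> carrier (B m)"
  shows "lres (B m) a b = \<one>\<^bsub>B m\<^esub> \<Longrightarrow> a = \<one>\<^bsub>B m\<^esub> \<and> b = \<one>\<^bsub>B m\<^esub>"
    and "rres (B m) b a = \<one>\<^bsub>B m\<^esub> \<Longrightarrow> a = \<one>\<^bsub>B m\<^esub> \<and> b = \<one>\<^bsub>B m\<^esub>"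
proof -
  interpret Bm: idempotent_residuated_chain "B m"
    using irc m by blast
  have ne: "lneg (B m) a \<noteq> \<one>\<^bsub>B m\<^esub>" "rneg (B m) a \<noteq> \<one>\<^bsub>B m\<^esub>" if "a \<noteq> \<one>\<^bsub>B m\<^esub>"
    using nestable m ab that by (auto simp: nestable_def)
  \<comment> \<open>\<open>w\<close> stands for either negation of \<open>a\<close>. A residual
    equal to 1 gives \<open>a \<preceq> b\<close> and is then the join of \<open>w\<close> and
    \<open>b\<close>, so \<open>b\<close> and hence \<open>a\<close> are negative. This makes
    \<open>w\<close> equal to 1, which for \<open>a\<close> other than 1 the side condition
    forbids.\<close>
  have key: "a = \<one>\<^bsub>B m\<^esub> \<and> b = \<one>\<^bsub>B m\<^esub>"
    if le: "rl_le (B m) a b" and v: "vee (B m) w b = \<one>\<^bsub>B m\<^esub>"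
      and w: "w \<in> carrier (B m)" "a \<noteq> \<one>\<^bsub>B m\<^esub> \<Longrightarrow> w \<noteq> \<one>\<^bsub>B m\<^esub>"
        "rl_le (B m) a \<one>\<^bsub>B m\<^esub> \<Longrightarrow> rl_le (B m) \<one>\<^bsub>B m\<^esub> w" for w
  proof -
    have "rl_le (B m) w \<one>\<^bsub>B m\<^esub>" "rl_le (B m) b \<one>\<^bsub>B m\<^esub>"
      using v Bm.vee_eq[of w b] Bm.not_le[of w b] w(1) ab Bm.le_refl by (auto split: if_splits)
    moreover from this have "rl_le (B m) a \<one>\<^bsub>B m\<^esub>"
      using Bm.le_trans le ab by blast
    ultimately have "w = \<one>\<^bsub>B m\<^esub>"
      using w Bm.le_antisym by blast
    then have "a = \<one>\<^bsub>B m\<^esub>"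
      using w(2) by blast
    then show ?thesis
      using le \<open>rl_le (B m) b \<one>\<^bsub>B m\<^esub>\<close> Bm.le_antisym ab by blast
  qed
  show "a = \<one>\<^bsub>B m\<^esub> \<and> b = \<one>\<^bsub>B m\<^esub>" if l: "lres (B m) a b = \<one>\<^bsub>B m\<^esub>"
  proof (rule key)
    show le: "rl_le (B m) a b"
      using Bm.lres_residual[of a "\<one>\<^bsub>B m\<^esub>" b] l ab by (simp add: Bm.le_refl)
    show "vee (B m) (rneg (B m) a) b = \<one>\<^bsub>B m\<^esub>"
      using l le ab by (simp add: Bm.lres_eq)
  qed (use ne ab in \<open>auto simp: Bm.le_rneg_iff\<close>)
  show "a = \<one>\<^bsub>B m\<^esub> \<and> b = \<one>\<^bsub>B m\<^esub>" if l: "rres (B m) b a = \<one>\<^bsub>B m\<^esub>"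
  proof (rule key)
    show le: "rl_le (B m) a b"
      using Bm.rres_residual[of "\<one>\<^bsub>B m\<^esub>" a b] l ab by (simp add: Bm.le_refl)
    show "vee (B m) (lneg (B m) a) b = \<one>\<^bsub>B m\<^esub>"
      using l le ab by (simp add: Bm.rres_eq)
  qed (use ne ab in \<open>auto simp: Bm.le_lneg_iff\<close>)
qed

text \<open>Handles the summand that is exempt from the side condition.\<close>

lemma index_ge_top:
  assumes "index_ge r m x" "\<forall>j\<in>I. (j, m) \<in> r" "x \<in> carrier N" "\<not> has_index m x"
  shows "x = None"
  using assms(3,1,2,4) by (elim carrier_cases) (auto dest: r_antisym)

lemma nested_ops [simp]:
  "mult N = nest_op r B mult" "lres N = nest_op r B lres" "rres N = nest_op r B rres"
  "\<one>\<^bsub>N\<^esub> = None"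
  "wedge N x y = (if nest_le r B x y then x else y)" "vee N x y = (if nest_le r B x y then y else x)"
  by (simp_all add: nested_sum_def)

lemma mult_closed:
  assumes "x \<in> carrier N" "y \<in> carrier N"
  shows "nest_op r B mult x y \<in> carrier N"
  using assms by (rule op_closed) (use mon monoid.m_closed in fast)

lemma lres_closed:
  assumes "x \<in> carrier N" "y \<in> carrier N"
  shows "nest_op r B lres x y \<in> carrier N"
  using assms
  by (rule op_closed) (meson irc idempotent_residuated_chain_def residuated_lattice.lres_closed)

lemma rres_closed:
  assumes "x \<in> carrier N" "y \<in> carrier N"
  shows "nest_op r B rres x y \<in> carrier N"
  using assms
  by (rule op_closed) (meson irc idempotent_residuated_chain_def residuated_lattice.rres_closed)

lemma proj_mult_eq_one_iff:
  assumes "m \<in> I" "x \<in> carrier N" "y \<in> carrier N"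
  shows "proj B m x \<otimes>\<^bsub>B m\<^esub> proj B m y = \<one>\<^bsub>B m\<^esub> \<longleftrightarrow> \<not> has_index m x \<and> \<not> has_index m y"
  using idempotent_residuated_chain.mult_eq_one_iff[OF irc] assms proj_closed proj_eq_one_iff
  by metis

lemma nested_monoid: "monoid N"
proof
  fix x y z assume c: "x \<in> carrier N" "y \<in> carrier N" "z \<in> carrier N"
  let ?l = "nest_op r B mult (nest_op r B mult x y) z"
  let ?r = "nest_op r B mult x (nest_op r B mult y z)"
  from c have "?l = ?r"
  proof (cases rule: obtain_min)
    case 1
    then show ?thesis
      by (simp add: nest_op_def)
  next
    case (2 m)
    then interpret Bm: idempotent_residuated_chain "B m"
      using irc by blast
    have l: "proj B m ?l = (proj B m x \<otimes>\<^bsub>B m\<^esub> proj B m y) \<otimes>\<^bsub>B m\<^esub> proj B m z"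
      using 2 c by (simp add: proj_op index_ge_op mult_closed one_one)
    have r: "proj B m ?r = proj B m x \<otimes>\<^bsub>B m\<^esub> (proj B m y \<otimes>\<^bsub>B m\<^esub> proj B m z)"
      using 2 c by (simp add: proj_op index_ge_op mult_closed one_one)
    have "proj B m ?l = proj B m ?r"
      unfolding l r using 2 c proj_closed by (simp add: Bm.m_assoc)
    \<comment> \<open>Some factor has index \<open>m\<close>, and products do not collapse, so both
      sides have index \<open>m\<close> and are recovered from their projections.\<close>
    moreover have "proj B m ?l \<noteq> \<one>\<^bsub>B m\<^esub>"
      unfolding l using 2 c proj_closed by (auto simp: Bm.mult_eq_one_iff proj_eq_one_iff)
    ultimately show ?thesis
      using proj_inject proj_eq_one_iff c mult_closed by metis
  qed
  then show "x \<otimes>\<^bsub>N\<^esub> y \<otimes>\<^bsub>N\<^esub> z = x \<otimes>\<^bsub>N\<^esub> (y \<otimes>\<^bsub>N\<^esub> z)"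
    by simp
next
  fix x assume "x \<in> carrier N"
  then show "\<one>\<^bsub>N\<^esub> \<otimes>\<^bsub>N\<^esub> x = x" "x \<otimes>\<^bsub>N\<^esub> \<one>\<^bsub>N\<^esub> = x"
    by (auto elim!: carrier_cases simp: nest_op_def nest_emb_def monoid.l_one monoid.r_one mon)
qed (simp_all add: mult_closed)

lemma nested_idem: "x \<in> carrier N \<Longrightarrow> nest_op r B mult x x = x"
  by (auto elim!: carrier_cases simp: nest_op_def nest_emb_def idempotent_residuated_chain.idem irc)

lemma nested_lres:
  assumes c: "x \<in> carrier N" "y \<in> carrier N" "z \<in> carrier N"
  shows "nest_le r B y (nest_op r B lres x z) \<longleftrightarrow> nest_le r B (nest_op r B mult x y) z"
  using c
proof (cases rule: obtain_min)
  case 1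
  then show ?thesis
    by (simp add: nest_op_def)
next
  case (2 m)
  then interpret Bm: idempotent_residuated_chain "B m"
    using irc by blast
  let ?w = "nest_op r B lres x z" and ?v = "nest_op r B mult x y"
  have w: "?w \<in> carrier N" "index_ge r m ?w" "proj B m ?w = lres (B m) (proj B m x) (proj B m z)"
    using 2 c by (simp_all add: proj_op index_ge_op lres_closed one_one)
  have v: "?v \<in> carrier N" "index_ge r m ?v" "proj B m ?v = proj B m x \<otimes>\<^bsub>B m\<^esub> proj B m y"
    using 2 c by (simp_all add: proj_op index_ge_op mult_closed one_one)
  \<comment> \<open>To transfer the inequality to \<open>B m\<close>, index \<open>m\<close> must
    occur in it. If it comes from \<open>x\<close> or \<open>z\<close> alone, the residual keeps it
    by \<open>residual_eq_one\<close>, unless \<open>m\<close> is the top.\<close>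
  have "has_index m y \<or> has_index m ?w \<or> y = None \<and> ?w = None"
  proof (cases "\<forall>j\<in>I. (j, m) \<in> r")
    case True
    then show ?thesis
      using index_ge_top w c 2 by blast
  next
    case False
    then have "has_index m ?w" if "has_index m x \<or> has_index m z"
      using that residual_eq_one(1)[OF 2(1) False, of "proj B m x" "proj B m z"] w c
        proj_closed[OF 2(1)] proj_eq_one_iff by metis
    then show ?thesis
      using 2 by blast
  qed
  moreover have "has_index m ?v \<or> has_index m z \<or> ?v = None \<and> z = None"
    using proj_mult_eq_one_iff[OF 2(1) c(1,2)] proj_eq_one_iff v 2 by metis
  ultimately show ?thesis
    using nest_le_iff[of m y ?w] nest_le_iff[of m ?v z] w v 2 c proj_closed Bm.lres_residual
    by simp
qed

lemma nested_rres:
  assumes c: "x \<in> carrier N" "y \<in> carrier N" "z \<in> carrier N"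
  shows "nest_le r B (nest_op r B mult x y) z \<longleftrightarrow> nest_le r B x (nest_op r B rres z y)"
  using c
proof (cases rule: obtain_min)
  case 1
  then show ?thesis
    by (simp add: nest_op_def)
next
  case (2 m)
  then interpret Bm: idempotent_residuated_chain "B m"
    using irc by blast
  let ?w = "nest_op r B rres z y" and ?v = "nest_op r B mult x y"
  have w: "?w \<in> carrier N" "index_ge r m ?w" "proj B m ?w = rres (B m) (proj B m z) (proj B m y)"
    using 2 c by (simp_all add: proj_op index_ge_op rres_closed one_one)
  have v: "?v \<in> carrier N" "index_ge r m ?v" "proj B m ?v = proj B m x \<otimes>\<^bsub>B m\<^esub> proj B m y"
    using 2 c by (simp_all add: proj_op index_ge_op mult_closed one_one)
  have "has_index m x \<or> has_index m ?w \<or> x = None \<and> ?w = None"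
  proof (cases "\<forall>j\<in>I. (j, m) \<in> r")
    case True
    then show ?thesis
      using index_ge_top w c 2 by blast
  next
    case False
    then have "has_index m ?w" if "has_index m y \<or> has_index m z"
      using that residual_eq_one(2)[OF 2(1) False, of "proj B m y" "proj B m z"] w c
        proj_closed[OF 2(1)] proj_eq_one_iff by metis
    then show ?thesis
      using 2 by blast
  qed
  moreover have "has_index m ?v \<or> has_index m z \<or> ?v = None \<and> z = None"
    using proj_mult_eq_one_iff[OF 2(1) c(1,2)] proj_eq_one_iff v 2 by metis
  ultimately show ?thesis
    using nest_le_iff[of m x ?w] nest_le_iff[of m ?v z] w v 2 c proj_closed Bm.rres_residual
    by simp
qed

lemma nested_irc: "idempotent_residuated_chain N"
  and rl_le_nested: "x \<in> carrier N \<Longrightarrow> rl_le N x y \<longleftrightarrow> nest_le r B x y"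
proof -
  note * = nested_monoid nested_idem lres_closed rres_closed nest_le_total nest_le_antisym
    nest_le_trans nested_lres nested_rres
  show "idempotent_residuated_chain N"
    by (rule irc_of_linear_order(1)[of N "nest_le r B"]) (unfold nested_ops, (fact * | rule refl)+)
  show "rl_le N x y \<longleftrightarrow> nest_le r B x y" if "x \<in> carrier N"
    using that nest_le_total[OF that that] by (auto simp: rl_le_def)
qed

lemma star_nest_emb:
  assumes i: "i \<in> I" and a: "a \<in> carrier (B i)"
  shows "rl_star N (nest_emb B i a) = nest_emb B i (rl_star (B i) a)"
proof -
  interpret Bi: idempotent_residuated_chain "B i"
    using irc i by blast
  have le: "nest_le r B (nest_emb B i u) (nest_emb B i v) \<longleftrightarrow> rl_le (B i) u v"
    if "u \<in> carrier (B i)" "v \<in> carrier (B i)" for u v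
    using that by (simp add: nest_le_def nest_emb_def Bi.le_refl)
  have "lneg N (nest_emb B i a) = nest_emb B i (lneg (B i) a)"
    "rneg N (nest_emb B i a) = nest_emb B i (rneg (B i) a)"
    using one_one[OF i] by (auto simp: lneg_def rneg_def nest_op_def nest_emb_def)
  then show ?thesis
    using a by (simp add: rl_star_def le Bi.wedge_eq)
qed

lemma nested_star_involutive:
  assumes "\<And>i. i \<in> I \<Longrightarrow> star_involutive_irc (B i)"
  shows "star_involutive_irc N"
proof -
  interpret N: idempotent_residuated_chain N
    by (rule nested_irc)
  have "rl_star N (rl_star N x) = x" if "x \<in> carrier N" for x
    using that
  proof (cases rule: carrier_cases)
    case None
    then show ?thesis
      using N.star_one by simp
  next
    case (Some i a)
    interpret Bi: star_involutive_irc "B i"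
      using assms Some by blast
    have "x = nest_emb B i a"
      using Some by (simp add: nest_emb_def)
    then show ?thesis
      using Some by (simp add: star_nest_emb Bi.star_star)
  qed
  then show ?thesis
    by unfold_locales
qed

end

section \<open>Decomposition\<close>

context star_involutive_irc
begin

text \<open>Each negation is the star or \<open>circ\<close>, and neither of these sends a
  non-identity element to 1. This yields the side condition of \<open>nestable\<close> for every
  component.\<close>

lemma neg_eq_one:
  assumes "x \<in> carrier A" "lneg A x = \<one> \<or> rneg A x = \<one>"
  shows "x = \<one>"
proof -
  have "rl_star A x = \<one> \<or> circ A x = \<one>"
    using assms by (auto simp: rl_star_def circ_def wedge_eq vee_eq)
  then show ?thesis
    using assms(1) star_eq_one_iff circ_eq_one_iff by blast
qed

text \<open>\<open>x\<close> enters only through \<open>gen x\<close>, so all non-identity elements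
  of a component share one representative, which serves as its index. A positive one is taken so
  that \<open>pos_mult\<close> compares components.\<close>

definition rep :: "'a \<Rightarrow> 'a" where
  "rep x = (SOME y. y \<in> gen x \<and> \<one> \<preceq> y \<and> y \<noteq> \<one>)"

lemma rep:
  assumes "x \<in> carrier A" "x \<noteq> \<one>"
  shows "rep x \<in> gen x" "\<one> \<preceq> rep x" "rep x \<noteq> \<one>" "rep x \<in> carrier A" "gen (rep x) = gen x"
proof -
  have "\<exists>y. y \<in> gen x \<and> \<one> \<preceq> y \<and> y \<noteq> \<one>"
  proof (cases "\<one> \<preceq> x")
    case True
    then show ?thesis
      using gen_self assms(2) by blast
  next
    case False
    then have "\<one> \<preceq> rl_star A x" "rl_star A x \<noteq> \<one>"
      using star_nonneg not_le assms star_eq_one_iff by simp_all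
    then show ?thesis
      using star_in_gen gen_self assms(1) by blast
  qed
  then show r: "rep x \<in> gen x" "\<one> \<preceq> rep x" "rep x \<noteq> \<one>"
    unfolding rep_def by (metis (mono_tags, lifting) someI_ex)+
  then show "rep x \<in> carrier A" "gen (rep x) = gen x"
    using gen_closed gen_eq assms(1) by blast+
qed

text \<open>The index order is reversed: the product of positive elements is the larger one, so the
  larger representative is \<open>below\<close> the smaller one and comes earlier. By
  \<open>below_gen\<close> this relation extends to the whole components.\<close>

lemma nested_decomposition:
  defines "I \<equiv> rep ` (carrier A - {\<one>})"
  defines "r \<equiv> {(i, j). i \<in> I \<and> j \<in> I \<and> j \<preceq> i}"
  defines "B \<equiv> \<lambda>i. A\<lparr>carrier := gen i\<rparr>"
  shows "nestable I r B" "i \<in> I \<Longrightarrow> crownian (B i)" "rl_isomorphic (nested_sum I r B) A"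
proof -
  have I: "i \<in> carrier A \<and> \<one> \<preceq> i \<and> i \<noteq> \<one> \<and> rep i = i" if i: "i \<in> I" for i
  proof -
    obtain x where x: "x \<in> carrier A" "x \<noteq> \<one>" "i = rep x"
      using i by (auto simp: I_def)
    then have "rep i = rep x"
      using rep(5)[of x] by (simp add: rep_def)
    then show ?thesis
      using x rep by simp
  qed
  have sub: "carrier (B i) \<subseteq> carrier A" "idempotent_residuated_chain (B i)" if "i \<in> I" for i
    using I[OF that] gen_subset_carrier subuniverse_irc subuniverse_gen by (simp_all add: B_def)
  have ops: "mult (B i) = mult A" "lres (B i) = lres A" "rres (B i) = rres A" "one (B i) = \<one>"
    "rl_le (B i) = rl_le A" "lneg (B i) = lneg A" "rneg (B i) = rneg A" "carrier (B i) = gen i" for i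
    by (simp_all add: B_def rl_le_def lneg_def rneg_def fun_eq_iff)
  show cr: "crownian (B i)" if "i \<in> I" for i
    using I[OF that] crownian_gen by (simp add: B_def)
  have "linear_order_on I r"
    unfolding linear_order_on_def partial_order_on_def preorder_on_def
  proof (intro conjI)
    show "r \<subseteq> I \<times> I"
      by (auto simp: r_def)
    show "refl_on I r"
      using I le_refl by (auto simp: r_def refl_on_def)
    show "trans r"
    proof (rule transI)
      fix i j k
      assume "(i, j) \<in> r" "(j, k) \<in> r"
      then show "(i, k) \<in> r"
        using I le_trans[of k j i] by (auto simp: r_def)
    qed
    show "antisym r"
      using I le_antisym by (intro antisymI) (auto simp: r_def)
    show "total_on I r"
      using I le_total by (auto simp: r_def total_on_def)
  qed
  moreover have "lneg (B i) a \<noteq> \<one>\<^bsub>B i\<^esub> \<and> rneg (B i) a \<noteq> \<one>\<^bsub>B i\<^esub>"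
    if "i \<in> I" "a \<in> carrier (B i)" "a \<noteq> \<one>\<^bsub>B i\<^esub>" for i a
    using that sub neg_eq_one[of a] by (auto simp: ops)
  ultimately show nest: "nestable I r B"
    using sub by (simp add: nestable_def)
  interpret nested I r B
    by unfold_locales (rule nest)
  have index_unique: "i = j" if "i \<in> I" "j \<in> I" "a \<in> gen i" "a \<in> gen j" "a \<noteq> \<one>" for i j a
  proof -
    have "gen i = gen j"
      using gen_eq[of a i] gen_eq[of a j] I that by simp
    then have "rep i = rep j"
      by (simp add: rep_def)
    then show ?thesis
      using I that by simp
  qed
  have below: "below A a b"
    if ij: "(i, j) \<in> r" "i \<noteq> j" and ab: "a \<in> gen i" "a \<noteq> \<one>" "b \<in> gen j" "b \<noteq> \<one>" for i j a b
  proof (rule below_gen[OF _ _ _ _ _ ab])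
    have ijI: "i \<in> I" "j \<in> I" "j \<preceq> i"
      using ij by (auto simp: r_def)
    then have "\<not> i \<preceq> j"
      using I ij(2) le_antisym by blast
    then show "below A i j"
      using ijI I[of i] I[of j] ij(2) by (simp add: below_def pos_mult)
    show "j \<notin> gen i"
      using index_unique[of i j j] ijI I[of j] ij(2) gen_self by blast
    show "j \<noteq> \<one>" "i \<in> carrier A" "j \<in> carrier A"
      using I ijI by blast+
  qed
  define h where "h = case_option \<one> (snd :: 'a \<times> 'a \<Rightarrow> 'a)"
  have h_simps [simp]: "h None = \<one>" "h (Some (i, a)) = a" "h (nest_emb B i a) = a" for i a
    by (simp_all add: h_def nest_emb_def ops)
  have bij: "bij_betw h (carrier N) (carrier A)"
  proof (rule bij_betw_imageI)
    show "inj_on h (carrier N)"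
      by (rule inj_onI) (auto elim!: carrier_cases simp: ops dest: index_unique)
    have "x \<in> h ` carrier N" if x: "x \<in> carrier A" for x
    proof (cases "x = \<one>")
      case True
      then show ?thesis
        using image_eqI[of x h None] by simp
    next
      case False
      then have "Some (rep x, x) \<in> carrier N"
        using x rep[of x] gen_self[of x] by (auto simp: nested_sum_def ops I_def)
      then show ?thesis
        using image_eqI[of x h "Some (rep x, x)"] by simp
    qed
    moreover have "h x \<in> carrier A" if "x \<in> carrier N" for x
      using that sub(1) by (auto elim!: carrier_cases simp: subset_iff)
    ultimately show "h ` carrier N = carrier A"
      by blast
  qed
  have mult: "h (x \<otimes>\<^bsub>N\<^esub> y) = h x \<otimes> h y" if x: "x \<in> carrier N" and y: "y \<in> carrier N" for x y
    using x
  proof (cases rule: carrier_cases)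
    case None
    then show ?thesis
      using y sub by (auto elim!: carrier_cases simp: nest_op_def ops(1,4))
  next
    case (Some i a)
    note Some_i = this
    from y show ?thesis
    proof (cases rule: carrier_cases)
      case None
      then show ?thesis
        using Some_i sub by (auto simp: nest_op_def ops(1,4))
    next
      case (Some j b)
      have c: "a \<in> carrier A" "b \<in> carrier A"
        using Some Some_i sub by blast+
      then show ?thesis
        using Some Some_i below[of i j a b] below[of j i b a] r_total[of i j]
        by (auto simp: nest_op_def ops below_def)
    qed
  qed
  have le: "nest_le r B x y \<longleftrightarrow> h x \<preceq> h y" if x: "x \<in> carrier N" and y: "y \<in> carrier N" for x y
    using x
  proof (cases rule: carrier_cases)
    case None
    then show ?thesis
      using y by (auto elim!: carrier_cases simp: nest_le_def ops le_refl)
  next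
    case (Some i a)
    note Some_i = this
    from y show ?thesis
    proof (cases rule: carrier_cases)
      case None
      then show ?thesis
        using Some_i by (simp add: nest_le_def ops)
    next
      case (Some j b)
      have c: "a \<in> carrier A" "b \<in> carrier A" "a \<noteq> \<one>" "b \<noteq> \<one>"
        using Some Some_i sub by (auto simp: ops)
      have gen: "a \<in> gen i" "b \<in> gen j"
        using Some Some_i by (simp_all add: ops)
      consider "i = j" | "i \<noteq> j" "(i, j) \<in> r" | "i \<noteq> j" "(i, j) \<notin> r" "(j, i) \<in> r"
        using r_total Some Some_i by blast
      then show ?thesis
      proof cases
        case 1
        then show ?thesis
          using Some Some_i by (simp add: nest_le_def ops)
      next
        case 2
        then show ?thesis
          using Some Some_i le_iff_of_below[OF below[OF 2(2,1) gen(1) c(3) gen(2) c(4)] c(1,2)]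
          by (simp add: nest_le_def ops)
      next
        case 3
        have ba: "below A b a"
          using below[OF 3(3) _ gen(2) c(4) gen(1) c(3)] 3 by blast
        \<comment> \<open>Here \<open>b\<close> belongs to the earlier component, so its sign
          decides, as in the last branch of \<open>nest_le\<close>.\<close>
        have "a \<preceq> b \<longleftrightarrow> \<not> b \<preceq> a"
          using ba c not_le le_antisym by (metis below_def)
        also have "\<dots> \<longleftrightarrow> \<one> \<preceq> b"
          using le_iff_of_below[OF ba] c not_le[of b \<one>] le_antisym[of b \<one>] by auto
        finally show ?thesis
          using 3 Some Some_i by (simp add: nest_le_def ops)
      qed
    qed
  qed
  have "rl_iso N A h"
  proof (rule rl_isoI)
    show "idempotent_residuated_chain A"
      by unfold_locales
    show "rl_le N x y \<longleftrightarrow> h x \<preceq> h y" if "x \<in> carrier N" "y \<in> carrier N" for x y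
      using le[OF that] rl_le_nested[OF that(1)] by blast
  qed (fact nested_irc bij mult)+
  then show "rl_isomorphic (nested_sum I r B) A"
    by (auto simp: rl_isomorphic_def)
qed

lemma one_generated_Int:
  assumes "one_generated A S" "one_generated A T" "S \<noteq> T"
  shows "S \<inter> T = {\<one>}"
proof -
  obtain x y where "x \<in> carrier A" "S = gen x" "y \<in> carrier A" "T = gen y"
    using assms(1,2) by (auto simp: one_generated_def)
  then show ?thesis
    using gen_Int assms(3) by simp
qed

lemma one_generated_hull:
  assumes "one_generated A S" "x \<in> S" "x \<noteq> \<one>"
  shows "gen x = S"
proof -
  obtain y where "y \<in> carrier A" "S = gen y"
    using assms(1) by (auto simp: one_generated_def)
  then show ?thesis
    using gen_eq[of x y] assms(2,3) by simp
qed

end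

text \<open>A statement cannot quantify over types. For the decomposition, representatives in the
  type of \<open>A\<close> suffice as indices; the second conjunct covers nested sums over arbitrary
  index types.\<close>

theorem lemma4p22:
  shows "(\<forall>A :: 'a rl.
            star_involutive_irc A \<longleftrightarrow>
              (\<exists>(I :: 'a set) r (B :: 'a \<Rightarrow> 'a rl).
                 nestable I r B \<and> (\<forall>i \<in> I. crownian (B i)) \<and>
                 rl_isomorphic (nested_sum I r B) A))
       \<and> (\<forall>(I :: 'i set) r (B :: 'i \<Rightarrow> 'b rl).
            nestable I r B \<and> (\<forall>i \<in> I. crownian (B i)) \<longrightarrow>
              star_involutive_irc (nested_sum I r B))
       \<and> (\<forall>A :: 'a rl. star_involutive_irc A \<longrightarrow>
            (\<forall>S T. one_generated A S \<and> one_generated A T \<and> S \<noteq> T \<longrightarrow> S \<inter> T = {\<one>\<^bsub>A\<^esub>}) \<and>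
            (\<forall>S. one_generated A S \<longrightarrow>
               (\<forall>x \<in> S. x \<noteq> \<one>\<^bsub>A\<^esub> \<longrightarrow> subuniverse A hull {x} = S)))"
proof (intro conjI allI)
  fix A :: "'a rl"
  show "star_involutive_irc A \<longleftrightarrow>
      (\<exists>(I :: 'a set) r (B :: 'a \<Rightarrow> 'a rl). nestable I r B \<and> (\<forall>i \<in> I. crownian (B i)) \<and>
         rl_isomorphic (nested_sum I r B) A)"
  proof
    assume "star_involutive_irc A"
    then show "\<exists>(I :: 'a set) r (B :: 'a \<Rightarrow> 'a rl). nestable I r B \<and> (\<forall>i \<in> I. crownian (B i)) \<and>
         rl_isomorphic (nested_sum I r B) A"
      by (intro exI conjI ballI) (rule star_involutive_irc.nested_decomposition, assumption+)+
  next
    assume "\<exists>(I :: 'a set) r (B :: 'a \<Rightarrow> 'a rl). nestable I r B \<and> (\<forall>i \<in> I. crownian (B i)) \<and>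
         rl_isomorphic (nested_sum I r B) A"
    then obtain I :: "'a set" and r and B :: "'a \<Rightarrow> 'a rl"
      where "nestable I r B" "\<forall>i \<in> I. crownian (B i)" "rl_isomorphic (nested_sum I r B) A"
      by blast
    then have "star_involutive_irc (nested_sum I r B)"
      by (intro nested.nested_star_involutive nested.intro crownian_star_involutive) auto
    then show "star_involutive_irc A"
      using star_involutive_iso \<open>rl_isomorphic (nested_sum I r B) A\<close>
      unfolding rl_isomorphic_def by blast
  qed
next
  fix I :: "'i set" and r and B :: "'i \<Rightarrow> 'b rl"
  show "nestable I r B \<and> (\<forall>i \<in> I. crownian (B i)) \<longrightarrow> star_involutive_irc (nested_sum I r B)"
    by (intro impI nested.nested_star_involutive nested.intro crownian_star_involutive) auto
next
  fix A :: "'a rl"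
  show "star_involutive_irc A \<longrightarrow>
      (\<forall>S T. one_generated A S \<and> one_generated A T \<and> S \<noteq> T \<longrightarrow> S \<inter> T = {\<one>\<^bsub>A\<^esub>}) \<and>
      (\<forall>S. one_generated A S \<longrightarrow>
         (\<forall>x \<in> S. x \<noteq> \<one>\<^bsub>A\<^esub> \<longrightarrow> subuniverse A hull {x} = S))"
    using star_involutive_irc.one_generated_Int star_involutive_irc.one_generated_hull by metis
qed

end
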